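(* Let $A_0\in\mathbb{R}^{n\times n}$ be Metzler and $A_1,\ldots,A_N\in\mathbb{R}^{n\times n}$ entrywise nonnegative (so the system below is internally positive), and let $\bar h_1,\ldots,\bar h_N\ge0$. Consider $$\dot x(t)=A_0x(t)+\sum_{i=1}^NA_i\int_{t-h_i(t)}^tx(s)\,ds,$$ with delay functions $h_i:\mathbb{R}_{\ge0}\to[0,\bar h_i]$. The following statements are equivalent: (i) The system is asymptotically stable for all delay functions $h_i:\mathbb{R}_{\ge0}\to[0,\bar h_i]$, $i=1,\ldots,N$. (ii) $A_0+\sum_{i=1}^N\bar h_iA_i$ is Hurwitz stable. (iii) There exists $v\in\mathbb{R}^n_{>0}$ such that $v^T\left(A_0+\sum_{i=1}^N\bar h_iA_i\right)<0$. (iv) $A_0$ is Hurwitz stable and $-\left(\sum_{i=1}^N\bar h_iA_i\right)A_0^{-1}$ is Schur stable. (v) There exist diagonal positive definite $P,Q_1,\ldots,Q_N\in\mathbb{R}^{n\times n}$ such that $$A_0^TP+PA_0+\sum_{i=1}^N\left(Q_i+\bar h_i^2PA_iQ_i^{-1}A_i^TP\right)\prec0.$$ Moreover, when $N=1$, these statements are also equivalent to: (vi) $A_0$ is Hurwitz stable and $\bar h_1<1/\rho(A_0^{-1}A_1)$.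
   Context: A Metzler matrix has nonnegative off-diagonal entries; $\rho$ denotes spectral radius (with $1/0=+\infty$); vector inequalities are componentwise; $\prec0$ means negative definite; Schur stable means spectral radius less than 1. *)

theory Defs
  imports "HOL-Analysis.Analysis"
begin

definition metzler :: "real^'n^'n \<Rightarrow> bool" where
  "metzler M \<longleftrightarrow> (\<forall>i j. i \<noteq> j \<longrightarrow> 0 \<le> M$i$j)"

definition nonneg_mat :: "real^'n^'n \<Rightarrow> bool" where
  "nonneg_mat M \<longleftrightarrow> (\<forall>i j. 0 \<le> M$i$j)"

definition cmat :: "real^'n^'n \<Rightarrow> complex^'n^'n" where
  "cmat M = (\<chi> i j. complex_of_real (M$i$j))"

definition eigenvalues :: "real^'n^'n \<Rightarrow> complex set" where
  "eigenvalues M = {c. \<exists>v::complex^'n. v \<noteq> 0 \<and> cmat M *v v = c *s v}"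

definition spectral_radius :: "real^'n^'n \<Rightarrow> real" where
  "spectral_radius M = Sup (cmod ` eigenvalues M)"

definition hurwitz :: "real^'n^'n \<Rightarrow> bool" where
  "hurwitz M \<longleftrightarrow> (\<forall>c\<in>eigenvalues M. Re c < 0)"

definition schur_stable :: "real^'n^'n \<Rightarrow> bool" where
  "schur_stable M \<longleftrightarrow> spectral_radius M < 1"

definition neg_definite :: "real^'n^'n \<Rightarrow> bool" where
  "neg_definite M \<longleftrightarrow> (\<forall>x. x \<noteq> 0 \<longrightarrow> x \<bullet> (M *v x) < 0)"

definition pos_diag :: "real^'n^'n \<Rightarrow> bool" where
  "pos_diag P \<longleftrightarrow> (\<forall>i j. i \<noteq> j \<longrightarrow> P$i$j = 0) \<and> (\<forall>i. 0 < P$i$i)"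

definition max_delay :: "nat \<Rightarrow> (nat \<Rightarrow> real) \<Rightarrow> real" where
  "max_delay N hbar = Max ({0} \<union> hbar ` {1..N})"

definition dd_rhs :: "real^'n^'n \<Rightarrow> (nat \<Rightarrow> real^'n^'n) \<Rightarrow> nat \<Rightarrow> (nat \<Rightarrow> real \<Rightarrow> real)
    \<Rightarrow> (real \<Rightarrow> real^'n) \<Rightarrow> real \<Rightarrow> real^'n" where
  "dd_rhs A0 A N h x t = A0 *v x t + (\<Sum>i\<in>{1..N}. A i *v integral {t - h i t..t} x)"

text \<open>A (Caratheodory) solution on [-H, oo): continuous, satisfying the integral form of
  x'(t) = A0 x(t) + sum_i A_i int_{t-h_i(t)}^t x(s) ds for t >= 0; its restriction to
  [-H,0] is the initial function.\<close>
definition dd_solution :: "real^'n^'n \<Rightarrow> (nat \<Rightarrow> real^'n^'n) \<Rightarrow> nat \<Rightarrow> real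
    \<Rightarrow> (nat \<Rightarrow> real \<Rightarrow> real) \<Rightarrow> (real \<Rightarrow> real^'n) \<Rightarrow> bool" where
  "dd_solution A0 A N H h x \<longleftrightarrow>
     continuous_on {-H..} x \<and>
     (\<forall>t\<ge>0. dd_rhs A0 A N h x integrable_on {0..t} \<and>
            x t = x 0 + integral {0..t} (dd_rhs A0 A N h x))"

definition dd_asymp_stable :: "real^'n^'n \<Rightarrow> (nat \<Rightarrow> real^'n^'n) \<Rightarrow> nat \<Rightarrow> real
    \<Rightarrow> (nat \<Rightarrow> real \<Rightarrow> real) \<Rightarrow> bool" where
  "dd_asymp_stable A0 A N H h \<longleftrightarrow>
     (\<forall>\<epsilon>>0. \<exists>\<delta>>0. \<forall>x. dd_solution A0 A N H h x \<and> (\<forall>s\<in>{-H..0}. norm (x s) < \<delta>)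
                       \<longrightarrow> (\<forall>t\<ge>0. norm (x t) < \<epsilon>)) \<and>
     (\<forall>x. dd_solution A0 A N H h x \<longrightarrow> (x \<longlongrightarrow> 0) at_top)"

end

(* A Metzler matrix T is Hurwitz iff no nonzero w >= 0 satisfies T w >= 0, equivalently iff
   v^T T < 0 for some v > 0, equivalently iff T x < 0 for some x > 0. This reduces (iii)-(vi) to
   inverse positivity of -T and to Perron-Frobenius, which is a continuation argument: the largest
   l for which T - l I is unstable has a nonnegative kernel vector. If M is not Hurwitz, the same
   argument for A_0 + sum_i g_i(l) A_i - l I, with g_i(l) the integral of exp(l s) over [-h_i, 0],
   gives l >= 0 and a solution exp(l t) v for the constant maximal delays, which does not decay. If M is
   Hurwitz and M w < 0 with w > 0, then C exp(l t) w with a small l < 0 dominates all solutions. *)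
theory Submission
  imports Defs
begin

subsection \<open>Stability of Metzler matrices\<close>

text \<open>The delays are arbitrary functions of time, so \<open>dd_rhs\<close> can jump and a
  solution need not be differentiable where it would first touch a bound. Domination is therefore
  argued with integrals and a strict supersolution: the gap between \<open>exp_mat l *v w\<close>
  and \<open>l w\<close> absorbs the error terms. Constant maximal delays are the worst case because
  widening the window of a nonnegative integrand only adds to the right-hand side. The gains equal
  the maximal delays at exponent 0, do not exceed them at nonnegative exponents and are continuous:
  domination makes large exponents harmless, continuity leaves room for a negative one. Complex
  numbers enter only through the moduli of an eigenvector, which serve as a nonnegative test vector.
  For (iv) and (vi) the link is the factorisation of \<open>-(A0 + B)\<close> into \<open>A0\<close>
  and a shifted nonnegative matrix \<open>K - I\<close>, on either side.\<close>

text \<open>For Metzler matrices this real condition is equivalent to Hurwitz stability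
  (\<open>hurwitz_iff_stab\<close>); it spares any further work with complex eigenvalues.\<close>

definition stab :: "real^'n^'n \<Rightarrow> bool" where
  "stab T \<longleftrightarrow> (\<forall>w. (\<forall>j. 0 \<le> w$j) \<and> (\<forall>j. 0 \<le> (T *v w)$j) \<longrightarrow> w = 0)"

text \<open>Finiteness of the index type lets one perturbation serve all coordinates. Every small
  parameter below is found this way.\<close>

lemma eventually_vec_neg:
  fixes f :: "'a \<Rightarrow> real^'n"
  assumes "(f \<longlongrightarrow> L) F" "\<And>j. L$j < 0"
  shows "eventually (\<lambda>x. \<forall>j. f x $ j < 0) F"
proof (rule eventually_all_finite)
  fix j
  show "eventually (\<lambda>x. f x $ j < 0) F"
    using order_tendstoD(2)[OF tendsto_vec_nth[OF assms(1)] assms(2)] .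
qed

lemma inner_pos_neg:
  fixes v u :: "real^'n"
  assumes "\<And>j. v$j < 0" "\<And>j. 0 \<le> u$j" "u \<noteq> 0"
  shows "v \<bullet> u < 0"
proof -
  obtain k where k: "u$k \<noteq> 0" using \<open>u \<noteq> 0\<close> by (auto simp: vec_eq_iff)
  have "(\<Sum>j\<in>UNIV. v$j * u$j) < (\<Sum>j\<in>(UNIV::'n set). 0)"
  proof (rule sum_strict_mono_ex1)
    show "\<forall>j\<in>UNIV. v$j * u$j \<le> 0"
      using assms by (meson less_imp_le mult_nonpos_nonneg)
    show "\<exists>j\<in>UNIV. v$j * u$j < 0"
      using assms k by (metis UNIV_I less_le mult_neg_pos)
  qed simp
  then show ?thesis by (simp add: inner_vec_def)
qed

lemma inner_nonneg_vec:
  fixes v u :: "real^'n"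
  assumes "\<And>j. 0 \<le> v$j" "\<And>j. 0 \<le> u$j"
  shows "0 \<le> v \<bullet> u"
  using assms by (simp add: inner_vec_def sum_nonneg)

text \<open>Evaluating \<open>v\<close> against \<open>T *v w\<close> in two ways gives a
  nonnegative number and, unless \<open>w = 0\<close>, a negative one.\<close>

lemma stab_if_left:
  fixes T :: "real^'n^'n"
  assumes "\<And>j. 0 < v$j" "\<And>j. (v v* T)$j < 0"
  shows "stab T"
  unfolding stab_def
proof (intro allI impI)
  fix w :: "real^'n"
  assume w: "(\<forall>j. 0 \<le> w$j) \<and> (\<forall>j. 0 \<le> (T *v w)$j)"
  show "w = 0"
  proof (rule ccontr)
    assume "w \<noteq> 0"
    then have "(v v* T) \<bullet> w < 0" using w assms by (intro inner_pos_neg) auto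
    moreover have "0 \<le> v \<bullet> (T *v w)"
      using w assms by (intro inner_nonneg_vec) (auto intro: less_imp_le)
    ultimately show False by (simp add: dot_lmul_matrix)
  qed
qed

text \<open>A hyperplane separates the image of the standard simplex from the nonnegative orthant;
  its normal is nonnegative and becomes positive after a small perturbation.\<close>

lemma stab_imp_left:
  fixes T :: "real^'n^'n"
  assumes "stab T"
  obtains v where "\<And>j. 0 < v$j" "\<And>j. (v v* T)$j < 0"
proof -
  define D where "D = {w::real^'n. (\<forall>j. 0 \<le> w$j) \<and> (\<Sum>j\<in>UNIV. w$j) = 1}"
  define C where "C = {u::real^'n. \<forall>j. 0 \<le> u$j}"
  have axisD: "axis j 1 \<in> D" for j
    by (auto simp: D_def axis_def)
  have "convex D"
    unfolding convex_def D_def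
    by (auto simp: sum.distrib sum_distrib_left[symmetric])
  moreover have "compact D"
  proof -
    have "norm w \<le> 1" if "w \<in> D" for w
    proof -
      have "norm w \<le> (\<Sum>j\<in>UNIV. \<bar>w$j\<bar>)" by (rule norm_le_l1_cart)
      also have "\<dots> = 1" using that by (simp add: D_def)
      finally show ?thesis .
    qed
    then have "bounded D" unfolding bounded_iff by blast
    moreover have "closed D"
      unfolding D_def
      by (intro closed_Collect_conj closed_Collect_all closed_Collect_le closed_Collect_eq continuous_intros)
    ultimately show ?thesis by (simp add: compact_eq_bounded_closed)
  qed
  ultimately have imD: "convex ((*v) T ` D)" "compact ((*v) T ` D)"
    by (auto intro!: convex_linear_image compact_continuous_image linear_continuous_on
        simp: linear_conv_bounded_linear[symmetric])
  have C: "convex C" "closed C"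
    unfolding C_def
    by (auto simp: convex_def intro!: closed_Collect_all closed_Collect_le continuous_intros)
  have disj: "(*v) T ` D \<inter> C = {}"
  proof (rule ccontr)
    assume "(*v) T ` D \<inter> C \<noteq> {}"
    then obtain w where w: "w \<in> D" "T *v w \<in> C" by auto
    then have "w = 0" using assms by (auto simp: stab_def C_def D_def)
    with w show False by (simp add: D_def)
  qed
  obtain a b where ab: "\<And>w. w \<in> D \<Longrightarrow> a \<bullet> (T *v w) < b" "\<And>u. u \<in> C \<Longrightarrow> b < a \<bullet> u"
    using separating_hyperplane_compact_closed[OF imD _ C disj] axisD by blast
  have "b < 0" using ab(2)[of 0] by (simp add: C_def)
  have a0: "0 \<le> a$j" for j
  proof (rule ccontr)
    assume "\<not> 0 \<le> a$j"
    then have "a$j < 0" by simp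
    \<comment> \<open>Scaled so that its inner product with \<open>a\<close> is exactly
      \<open>b\<close>, against strict separation.\<close>
    have "axis j (b / a$j) \<in> C"
      using \<open>b < 0\<close> \<open>a$j < 0\<close> by (auto simp: C_def axis_def divide_nonpos_nonpos)
    from ab(2)[OF this] \<open>a$j < 0\<close> show False by (simp add: inner_axis)
  qed
  have aT: "(a v* T)$j < 0" for j
  proof -
    have "(a v* T) \<bullet> axis j 1 < b"
      using ab(1)[OF axisD] by (simp add: dot_lmul_matrix)
    then show ?thesis using \<open>b < 0\<close> by (simp add: inner_axis)
  qed
  have "((\<lambda>e. (\<chi> j. a$j + e) v* T) \<longlongrightarrow> (\<chi> j. a$j + 0) v* T) (at_right (0::real))"
    unfolding vector_matrix_mult_def
    by (intro tendsto_intros)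
  then have "eventually (\<lambda>e. \<forall>j. ((\<chi> j. a$j + e) v* T) $ j < 0) (at_right (0::real))"
    by (rule eventually_vec_neg) (use aT in simp)
  moreover have "eventually (\<lambda>e. 0 < e) (at_right (0::real))"
    by (simp add: eventually_at_right_less)
  ultimately have "eventually (\<lambda>e. 0 < e \<and> (\<forall>j. ((\<chi> j. a$j + e) v* T) $ j < 0)) (at_right (0::real))"
    by eventually_elim auto
  then obtain e where "0 < e" "\<forall>j. ((\<chi> j. a$j + e) v* T) $ j < 0"
    using eventually_happens'[OF trivial_limit_at_right_real] by blast
  then show thesis
    using a0 by (intro that[of "\<chi> j. a$j + e"]) (auto intro: add_nonneg_pos)
qed

section \<open>Inverse positivity and right-hand witnesses of stability\<close>

lemma mult_vec_zero_coord_nonneg: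
  fixes T :: "real^'n^'n"
  assumes "metzler T" "\<And>j. 0 \<le> x$j" "x$i = 0"
  shows "0 \<le> (T *v x)$i"
  unfolding matrix_vector_mult_def vec_lambda_beta
proof (rule sum_nonneg)
  fix j show "0 \<le> T$i$j * x$j"
    using assms by (cases "i = j") (auto simp: metzler_def)
qed

text \<open>The negative part \<open>m\<close> of \<open>x\<close> is a test vector for
  \<open>stab\<close>. Where \<open>x\<close> is negative, the positive part \<open>p\<close>
  vanishes, so \<open>T *v p\<close> is nonnegative there and so is
  \<open>T *v m = T *v p - T *v x\<close>; elsewhere \<open>m\<close> itself vanishes.\<close>

lemma stab_inverse_pos:
  fixes T :: "real^'n^'n"
  assumes "metzler T" "stab T" "\<And>j. (T *v x)$j \<le> 0"
  shows "0 \<le> x$j"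
proof -
  define p where "p = (\<chi> j. max 0 (x$j))"
  define m where "m = (\<chi> j. max 0 (- x$j))"
  have x: "x = p - m" by (simp add: vec_eq_iff p_def m_def max_def)
  have "0 \<le> (T *v m)$i" for i
  proof (cases "x$i < 0")
    case True
    then have "0 \<le> (T *v p)$i"
      using \<open>metzler T\<close> by (intro mult_vec_zero_coord_nonneg) (auto simp: p_def)
    moreover have "T *v x = T *v p - T *v m" by (metis x matrix_vector_mult_diff_distrib)
    ultimately show ?thesis using assms(3)[of i] by simp
  next
    case False
    then show ?thesis
      using \<open>metzler T\<close> by (intro mult_vec_zero_coord_nonneg) (auto simp: m_def)
  qed
  then have "m = 0" using \<open>stab T\<close> by (auto simp: stab_def m_def)
  then have "x$j = p$j" using x by simp
  then show ?thesis by (simp add: p_def)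
qed

text \<open>By inverse positivity a kernel vector and its negative are both nonnegative.\<close>

lemma stab_invertible:
  fixes T :: "real^'n^'n"
  assumes "metzler T" "stab T"
  shows "invertible T"
proof -
  have "x = 0" if "T *v x = 0" for x
  proof -
    have "0 \<le> x$j" "0 \<le> (-x)$j" for j
      using stab_inverse_pos[OF assms, of x j] stab_inverse_pos[OF assms, of "-x" j] that
      by (auto simp: vec.neg)
    then show ?thesis by (auto simp: vec_eq_iff intro!: antisym)
  qed
  then show ?thesis
    by (auto simp: invertible_left_inverse matrix_left_invertible_ker)
qed

lemma stab_solve:
  fixes T :: "real^'n^'n"
  assumes "metzler T" "stab T"
  obtains x where "T *v x = b"
proof
  have "T ** matrix_inv T = mat 1"
    using stab_invertible[OF assms] unfolding invertible_def matrix_inv_def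
    by (rule someI2_ex) simp
  then show "T *v (matrix_inv T *v b) = b"
    by (simp add: matrix_vector_mul_assoc)
qed

lemma stab_inverse_strict_pos:
  fixes T :: "real^'n^'n"
  assumes "metzler T" "stab T" "\<And>j. (T *v x)$j < 0"
  shows "0 < x$j"
proof (rule ccontr)
  have x0: "0 \<le> x$j" for j
    using stab_inverse_pos[OF assms(1,2), of x] assms(3) by (simp add: less_imp_le)
  assume "\<not> 0 < x$j"
  then have "x$j = 0" using x0[of j] by linarith
  then have "0 \<le> (T *v x)$j"
    using x0 assms by (intro mult_vec_zero_coord_nonneg) auto
  with assms(3)[of j] show False by simp
qed

lemma stab_imp_right_one:
  fixes T :: "real^'n^'n"
  assumes "metzler T" "stab T"
  obtains x where "\<And>j. 0 < x$j" "T *v x = - 1"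
proof -
  obtain x where x: "T *v x = - 1" using stab_solve[OF assms] by blast
  moreover have "0 < x$j" for j
    using stab_inverse_strict_pos[OF assms] by (simp add: x)
  ultimately show thesis using that by blast
qed

lemma metzler_transpose [simp]: "metzler (transpose T) \<longleftrightarrow> metzler T"
  by (auto simp: metzler_def transpose_def)

text \<open>A right witness for \<open>T\<close> is a left witness for the transpose. Stability of
  the transpose then yields a positive solution \<open>y\<close> of the transposed equation, which
  is a left witness for \<open>T\<close>.\<close>

lemma stab_if_right:
  fixes T :: "real^'n^'n"
  assumes "metzler T" "\<And>j. 0 < x$j" "\<And>j. (T *v x)$j < 0"
  shows "stab T"
proof -
  have "stab (transpose T)"
    using assms by (intro stab_if_left[of x]) (auto simp: transpose_matrix_vector[symmetric])
  then obtain y where "\<And>j. 0 < y$j" "transpose T *v y = - 1"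
    using stab_imp_right_one[of "transpose T"] assms by auto
  then show ?thesis
    by (intro stab_if_left[of y]) auto
qed

lemma stab_transpose:
  fixes T :: "real^'n^'n"
  assumes "metzler T"
  shows "stab (transpose T) \<longleftrightarrow> stab T"
proof -
  have *: "stab (transpose S)" if S: "metzler S" "stab S" for S :: "real^'n^'n"
  proof -
    obtain x where "\<And>j. 0 < x$j" "S *v x = - 1"
      using stab_imp_right_one[OF S] by auto
    then show ?thesis
      by (intro stab_if_left[of x]) (auto simp: transpose_matrix_vector[symmetric])
  qed
  show ?thesis using *[of T] *[of "transpose T"] assms by auto
qed

text \<open>Applied to \<open>T l = K - l I\<close> this gives the Perron eigenvector, applied to the
  characteristic matrix of the delay equation it gives an exponential solution. The kernel vector
  is a limit of the normalised solutions of \<open>T m x = -1\<close> as \<open>m\<close> decreases to \<open>l\<close>.\<close>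

lemma kernel_at_largest_unstable:
  fixes T :: "real \<Rightarrow> real^'n^'n"
  assumes cont: "continuous_on {a..} T" and met: "\<And>l. a \<le> l \<Longrightarrow> metzler (T l)"
    and uns: "\<not> stab (T a)" and st: "\<And>l. b \<le> l \<Longrightarrow> stab (T l)"
  obtains l v where "a \<le> l" "\<And>j. 0 \<le> v$j" "v \<noteq> 0" "T l *v v = 0" "\<And>m. l < m \<Longrightarrow> stab (T m)"
proof -
  define U where "U = {l. a \<le> l \<and> \<not> stab (T l)}"
  define L where "L = Sup U"
  have U: "a \<in> U" "bdd_above U"
    using uns st unfolding U_def bdd_above_def by (auto intro!: exI[of _ b]) (meson linear)
  have aL: "a \<le> L" unfolding L_def using U by (simp add: cSup_upper)
  have gtL: "stab (T m)" if "L < m" for m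
    using that aL cSup_upper[OF _ U(2), of m] by (force simp: L_def U_def)
  have Tlim: "((\<lambda>l. T l *v x) \<longlongrightarrow> T L *v x) (at L within {a..})" for x
    using cont aL unfolding continuous_on_def matrix_vector_mult_def
    by (auto intro!: tendsto_intros)
  have unsL: "\<not> stab (T L)"
  proof
    assume "stab (T L)"
    then obtain x where x: "\<And>j. 0 < x$j" "T L *v x = - 1"
      using stab_imp_right_one[of "T L"] met[OF aL] by auto
    \<comment> \<open>The witness \<open>x\<close> for \<open>T L\<close> still works for nearby
      parameters, so stability is an open condition and cannot hold at the supremum of the unstable
      parameters.\<close>
    have "eventually (\<lambda>l. \<forall>j. (T l *v x) $ j < 0) (at L within {a..})"
      by (rule eventually_vec_neg[OF Tlim]) (simp add: x)
    then have ev: "eventually (\<lambda>l. l \<in> {a..} \<longrightarrow> stab (T l)) (nhds L)"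
      unfolding eventually_at_filter
      by eventually_elim (metis atLeast_iff \<open>stab (T L)\<close> met stab_if_right x(1))
    then obtain d where d: "d > 0" "\<And>l. dist l L < d \<Longrightarrow> l \<in> {a..} \<Longrightarrow> stab (T l)"
      unfolding eventually_nhds_metric by blast
    obtain u where u: "u \<in> U" "L - d < u"
      using less_cSupD[of U "L - d"] U d by (auto simp: L_def)
    moreover have "u \<le> L" using u U by (simp add: L_def cSup_upper)
    ultimately show False using d by (auto simp: dist_real_def U_def)
  qed
  define m where "m n = L + 1 / real (Suc n)" for n
  have m: "L < m n" for n by (simp add: m_def)
  have "\<exists>x. (\<forall>j. 0 < x$j) \<and> T (m n) *v x = - 1" for n
    using stab_imp_right_one[OF met gtL] m[of n] aL by (metis less_le order_trans)
  then obtain x where x: "\<And>n j. 0 < x n $ j" "\<And>n. T (m n) *v x n = - 1" by metis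
  define z where "z n = x n /\<^sub>R norm (x n)" for n
  have xnz: "x n \<noteq> 0" for n using x(1)[of n] by (metis less_irrefl zero_index)
  have "z n \<in> sphere 0 1" for n using xnz by (simp add: z_def)
  then obtain v r where v: "v \<in> sphere 0 1" and r: "strict_mono r" "(z \<circ> r) \<longlonglongrightarrow> v"
    using compact_sphere[of "0::real^'n" 1] unfolding compact_def by blast
  have "(\<lambda>n. 1 / real (Suc n)) \<longlonglongrightarrow> 0"
    using LIMSEQ_inverse_real_of_nat by (simp add: inverse_eq_divide)
  then have "m \<longlonglongrightarrow> L" unfolding m_def using tendsto_add[OF tendsto_const[of L]] by fastforce
  then have mr: "(\<lambda>n. m (r n)) \<longlonglongrightarrow> L"
    using LIMSEQ_subseq_LIMSEQ[OF _ r(1)] by (auto simp: o_def)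
  have "(\<lambda>n. T (m (r n))) \<longlonglongrightarrow> T L"
  proof (rule continuous_on_tendsto_compose[OF cont mr])
    have "m n \<in> {a..}" for n using aL m[of n] by simp
    then show "\<forall>\<^sub>F n in sequentially. m (r n) \<in> {a..}" by simp
  qed (use aL in simp)
  then have lim: "(\<lambda>n. T (m (r n)) *v z (r n)) \<longlonglongrightarrow> T L *v v"
    using r(2) unfolding matrix_vector_mult_def o_def by (intro tendsto_intros)
  have Tz: "T (m n) *v z n = - (1 / norm (x n)) *\<^sub>R 1" for n
    by (simp add: z_def matrix_vector_mult_scaleR x(2) inverse_eq_divide)
  have v0: "0 \<le> v$j" for j
  proof (rule LIMSEQ_le_const[OF tendsto_vec_nth[OF r(2)]])
    show "\<exists>N. \<forall>n\<ge>N. 0 \<le> (z \<circ> r) n $ j"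
      using x(1) by (simp add: z_def less_imp_le)
  qed
  have Tle: "(T L *v v)$j \<le> 0" for j
  proof (rule LIMSEQ_le_const2[OF tendsto_vec_nth[OF lim]])
    have "(T (m (r n)) *v z (r n)) $ j \<le> 0" for n
      by (simp only: Tz vector_scaleR_component one_index) simp
    then show "\<exists>N. \<forall>n\<ge>N. (T (m (r n)) *v z (r n)) $ j \<le> 0" by blast
  qed
  \<comment> \<open>Nothing is known about the growth of \<open>norm (x n)\<close>, so the limit is
    only seen to be a nonpositive multiple of the all-ones vector. A nonzero multiple would make
    \<open>v\<close> a right witness for \<open>T L\<close>.\<close>
  have Teq: "(T L *v v)$i = (T L *v v)$j" for i j
  proof (rule LIMSEQ_unique[OF tendsto_vec_nth[OF lim]])
    have "(\<lambda>n. (T (m (r n)) *v z (r n)) $ i) = (\<lambda>n. (T (m (r n)) *v z (r n)) $ j)"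
      by (simp only: Tz vector_scaleR_component one_index)
    then show "(\<lambda>n. (T (m (r n)) *v z (r n)) $ i) \<longlonglongrightarrow> (T L *v v)$j"
      using tendsto_vec_nth[OF lim, of j] by (simp only:)
  qed
  have "T L *v v = 0"
  proof (rule ccontr)
    assume "T L *v v \<noteq> 0"
    then obtain k where "(T L *v v)$k \<noteq> 0" by (auto simp: vec_eq_iff)
    then have neg: "(T L *v v)$j < 0" for j using Tle[of j] Teq[of j k] by linarith
    have "0 < v$j" for j
      using mult_vec_zero_coord_nonneg[OF met[OF aL] v0, of j] neg[of j] v0[of j] by linarith
    then have "stab (T L)" using neg met[OF aL] by (intro stab_if_right) auto
    with unsL show False by simp
  qed
  moreover have "v \<noteq> 0" using v by auto
  ultimately show thesis using aL v0 gtL by (intro that[of L v])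
qed

section \<open>Monotonicity, scaling and shifts by multiples of the identity\<close>

lemma stab_mono:
  fixes S T :: "real^'n^'n"
  assumes "metzler S" "metzler T" "\<And>i j. S$i$j \<le> T$i$j" "stab T"
  shows "stab S"
proof -
  obtain x where x: "\<And>j. 0 < x$j" "T *v x = - 1"
    using stab_imp_right_one[OF assms(2,4)] by auto
  have "(S *v x)$i < 0" for i
  proof -
    have "(S *v x)$i \<le> (T *v x)$i"
      unfolding matrix_vector_mult_def vec_lambda_beta
      using assms(3) x(1) by (intro sum_mono mult_right_mono) (auto intro: less_imp_le)
    then show ?thesis by (simp add: x(2))
  qed
  then show ?thesis using x(1) assms(1) by (intro stab_if_right) auto
qed

lemma stab_scaleR:
  fixes T :: "real^'n^'n"
  assumes "0 < c"
  shows "stab (c *\<^sub>R T) \<longleftrightarrow> stab T"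
  using assms by (simp add: stab_def scaleR_matrix_vector_assoc[symmetric] zero_le_mult_iff)

lemma metzler_shift [simp]: "metzler (T - l *\<^sub>R mat 1) \<longleftrightarrow> metzler T"
  by (auto simp: metzler_def mat_def)

lemma nonneg_imp_metzler: "nonneg_mat K \<Longrightarrow> metzler K"
  by (simp add: metzler_def nonneg_mat_def)

lemma shift_mult_vec: "(T - l *\<^sub>R mat 1) *v x = T *v x - l *\<^sub>R (x :: real^'n)"
  by (simp add: matrix_vector_mult_diff_rdistrib scaleR_matrix_vector_assoc[symmetric])

text \<open>The all-ones vector is a right witness, since the sum of all absolute entries bounds
  every row sum.\<close>

lemma stab_shift_large:
  fixes T :: "real^'n^'n"
  assumes "metzler T" "(\<Sum>i\<in>UNIV. \<Sum>j\<in>UNIV. \<bar>T$i$j\<bar>) < l"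
  shows "stab (T - l *\<^sub>R mat 1)"
proof (rule stab_if_right[of _ 1])
  fix i
  have "(T *v 1)$i \<le> (\<Sum>j\<in>UNIV. \<bar>T$i$j\<bar>)"
    by (auto simp: matrix_vector_mult_def intro: sum_mono)
  also have "\<dots> \<le> (\<Sum>i\<in>UNIV. \<Sum>j\<in>UNIV. \<bar>T$i$j\<bar>)"
    by (rule member_le_sum) (auto intro: sum_nonneg)
  finally show "((T - l *\<^sub>R mat 1) *v 1)$i < 0"
    using assms(2) by (simp add: shift_mult_vec)
qed (use assms in auto)

text \<open>The eigenvalue \<open>l\<close> is the threshold of stability: the last conclusion says
  that no larger shift is unstable. This identifies it with the spectral radius for nonnegative
  matrices.\<close>

lemma shift_kernel:
  fixes T :: "real^'n^'n"
  assumes "metzler T" "\<not> stab (T - a *\<^sub>R mat 1)"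
  obtains l v where "a \<le> l" "\<And>j. 0 \<le> v$j" "v \<noteq> 0" "T *v v = l *\<^sub>R v"
    "\<And>m. l < m \<Longrightarrow> stab (T - m *\<^sub>R mat 1)"
proof -
  define b where "b = (\<Sum>i\<in>UNIV. \<Sum>j\<in>UNIV. \<bar>T$i$j\<bar>) + 1"
  obtain l v where *: "a \<le> l" "\<And>j. 0 \<le> v$j" "v \<noteq> 0" "(T - l *\<^sub>R mat 1) *v v = 0"
    "\<And>m. l < m \<Longrightarrow> stab (T - m *\<^sub>R mat 1)"
  proof (rule kernel_at_largest_unstable[of a "\<lambda>l. T - l *\<^sub>R mat 1" b])
    show "stab (T - l *\<^sub>R mat 1)" if "b \<le> l" for l
      using that assms(1) by (intro stab_shift_large) (auto simp: b_def)
  qed (use assms in \<open>auto intro!: continuous_intros\<close>)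
  then show thesis by (intro that[of l v]) (auto simp: shift_mult_vec)
qed

lemma unstable_kernel:
  fixes T :: "real^'n^'n"
  assumes "metzler T" "\<not> stab T"
  obtains l v where "0 \<le> l" "v \<noteq> 0" "T *v v = l *\<^sub>R v"
proof -
  have "\<not> stab (T - 0 *\<^sub>R mat 1)" using assms(2) by simp
  from assms(1) this show thesis by (rule shift_kernel) (rule that)
qed

subsection \<open>Eigenvalues and spectral radius\<close>

lemma real_eigenvalue:
  fixes T :: "real^'n^'n"
  assumes "T *v w = l *\<^sub>R w" "w \<noteq> 0"
  shows "complex_of_real l \<in> eigenvalues T"
proof -
  define z where "z = (\<chi> i. complex_of_real (w$i))"
  have "z \<noteq> 0" using assms(2) by (auto simp: z_def vec_eq_iff)
  moreover have "cmat T *v z = of_real l *s z"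
  proof -
    have "(\<Sum>j\<in>UNIV. T$i$j * w$j) = l * w$i" for i
      using arg_cong[OF assms(1), of "\<lambda>x. x$i"] by (simp add: matrix_vector_mult_def)
    then have "(\<Sum>j\<in>UNIV. complex_of_real (T$i$j) * of_real (w$j)) = of_real l * of_real (w$i)" for i
      by (metis (no_types, lifting) of_real_mult of_real_sum sum.cong)
    then show ?thesis
      by (simp add: vec_eq_iff z_def cmat_def matrix_vector_mult_def)
  qed
  ultimately show ?thesis unfolding eigenvalues_def by blast
qed

lemma eigenvector_row:
  assumes "cmat T *v z = c *s z"
  shows "(\<Sum>j\<in>UNIV. complex_of_real (T$i$j) * z$j) = c * z$i"
  using arg_cong[OF assms, of "\<lambda>x. x$i"] by (simp add: matrix_vector_mult_def cmat_def)

text \<open>The diagonal entry may be negative, so it is moved to the side of \<open>c\<close>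
  before the triangle inequality is applied. This is why only \<open>Re c\<close> survives.\<close>

lemma metzler_eigenvector_abs:
  fixes T :: "real^'n^'n"
  assumes "metzler T" "cmat T *v z = c *s z"
  shows "Re c * cmod (z$i) \<le> (T *v (\<chi> j. cmod (z$j)))$i"
proof -
  have "(c - of_real (T$i$i)) * z$i = (\<Sum>j\<in>UNIV - {i}. complex_of_real (T$i$j) * z$j)"
    using eigenvector_row[OF assms(2), of i] by (simp add: sum.remove[of UNIV i] algebra_simps)
  then have "cmod (c - of_real (T$i$i)) * cmod (z$i) \<le> (\<Sum>j\<in>UNIV - {i}. cmod (complex_of_real (T$i$j) * z$j))"
    by (metis norm_mult norm_sum)
  also have "\<dots> = (\<Sum>j\<in>UNIV - {i}. T$i$j * cmod (z$j))"
    using assms(1) by (intro sum.cong) (auto simp: metzler_def norm_mult)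
  finally have "cmod (c - of_real (T$i$i)) * cmod (z$i) \<le> (\<Sum>j\<in>UNIV - {i}. T$i$j * cmod (z$j))" .
  moreover have "(Re c - T$i$i) * cmod (z$i) \<le> cmod (c - of_real (T$i$i)) * cmod (z$i)"
    using complex_Re_le_cmod[of "c - of_real (T$i$i)"] by (intro mult_right_mono) auto
  ultimately show ?thesis
    by (simp add: matrix_vector_mult_def sum.remove[of UNIV i] algebra_simps)
qed

text \<open>With a nonnegative diagonal the triangle inequality applies to the whole row and keeps
  \<open>cmod c\<close>.\<close>

lemma nonneg_eigenvector_abs:
  fixes T :: "real^'n^'n"
  assumes "nonneg_mat T" "cmat T *v z = c *s z"
  shows "cmod c * cmod (z$i) \<le> (T *v (\<chi> j. cmod (z$j)))$i"
proof -
  have "cmod c * cmod (z$i) \<le> (\<Sum>j\<in>UNIV. cmod (complex_of_real (T$i$j) * z$j))"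
    using eigenvector_row[OF assms(2), of i] by (metis norm_mult norm_sum)
  also have "\<dots> = (\<Sum>j\<in>UNIV. T$i$j * cmod (z$j))"
    using assms(1) by (intro sum.cong) (auto simp: nonneg_mat_def norm_mult)
  finally show ?thesis by (simp add: matrix_vector_mult_def)
qed

text \<open>Instability produces a real eigenvalue \<open>l \<ge> 0\<close>. Conversely, the moduli
  of an eigenvector for \<open>c\<close> with nonnegative real part form a nonzero test vector that
  violates \<open>stab\<close>.\<close>

lemma hurwitz_iff_stab:
  fixes T :: "real^'n^'n"
  assumes "metzler T"
  shows "hurwitz T \<longleftrightarrow> stab T"
proof
  assume "hurwitz T"
  show "stab T"
  proof (rule ccontr)
    assume unstable: "\<not> stab T"
    obtain l v where l: "0 \<le> l" "v \<noteq> 0" "T *v v = l *\<^sub>R v"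
      by (rule unstable_kernel[OF assms unstable])
    then have "Re (of_real l) < 0"
      using real_eigenvalue[OF l(3,2)] \<open>hurwitz T\<close> unfolding hurwitz_def by blast
    with l(1) show False by simp
  qed
next
  assume T: "stab T"
  show "hurwitz T"
    unfolding hurwitz_def
  proof (rule ballI, rule ccontr)
    fix c assume "c \<in> eigenvalues T" and c: "\<not> Re c < 0"
    then obtain z where z: "z \<noteq> 0" "cmat T *v z = c *s z" by (auto simp: eigenvalues_def)
    have "0 \<le> (T *v (\<chi> j. cmod (z$j)))$i" for i
    proof (rule order_trans[OF _ metzler_eigenvector_abs[OF assms z(2)]])
      show "0 \<le> Re c * cmod (z$i)" using c by simp
    qed
    then have "(\<chi> j. cmod (z$j)) = 0" using T by (auto simp: stab_def)
    with z(1) show False by (auto simp: vec_eq_iff)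
  qed
qed

text \<open>The Perron root \<open>r\<close> is an eigenvalue and bounds the moduli of all
  eigenvalues, so the supremum equals \<open>r\<close>. Above \<open>r\<close> the shifts are
  stable; for \<open>0 \<le> s \<le> r\<close> the Perron vector violates
  \<open>stab\<close>.\<close>

lemma spectral_radius_nonneg_mat:
  fixes K :: "real^'n^'n"
  assumes "nonneg_mat K"
  shows "0 \<le> spectral_radius K"
    and "spectral_radius K < s \<Longrightarrow> stab (K - s *\<^sub>R mat 1)"
    and "0 \<le> s \<Longrightarrow> stab (K - s *\<^sub>R mat 1) \<Longrightarrow> spectral_radius K < s"
proof -
  have "\<not> stab (K - 0 *\<^sub>R mat 1)"
    using assms by (auto simp: stab_def nonneg_mat_def matrix_vector_mult_def
        intro!: exI[of _ 1] sum_nonneg)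
  then obtain r v where r: "0 \<le> r" "\<And>j. 0 \<le> v$j" "v \<noteq> 0" "K *v v = r *\<^sub>R v"
    "\<And>m. r < m \<Longrightarrow> stab (K - m *\<^sub>R mat 1)"
    using shift_kernel[OF nonneg_imp_metzler[OF assms], of 0] by metis
  have "cmod c \<le> r" if c: "c \<in> eigenvalues K" for c
  proof (rule ccontr)
    assume "\<not> cmod c \<le> r"
    then have st: "stab (K - cmod c *\<^sub>R mat 1)" using r(5) by simp
    obtain z where z: "z \<noteq> 0" "cmat K *v z = c *s z" using c by (auto simp: eigenvalues_def)
    have "(\<chi> j. cmod (z$j)) = 0"
      using st nonneg_eigenvector_abs[OF assms z(2)] by (auto simp: stab_def shift_mult_vec)
    with z(1) show False by (auto simp: vec_eq_iff)
  qed
  \<comment> \<open>Makes \<open>r\<close> a maximum, so that \<open>Sup\<close> is taken over a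
    nonempty bounded set.\<close>
  moreover have "r \<in> cmod ` eigenvalues K"
    using real_eigenvalue[OF r(4,3)] r(1) by (metis abs_of_nonneg image_eqI norm_of_real)
  ultimately have sr: "spectral_radius K = r"
    unfolding spectral_radius_def by (intro cSup_eq_maximum) auto
  show "0 \<le> spectral_radius K" using r(1) sr by simp
  show "stab (K - s *\<^sub>R mat 1)" if "spectral_radius K < s" using r(5) sr that by simp
  show "spectral_radius K < s" if "0 \<le> s" "stab (K - s *\<^sub>R mat 1)"
  proof (rule ccontr)
    assume "\<not> spectral_radius K < s"
    then have "0 \<le> ((K - s *\<^sub>R mat 1) *v v)$j" for j
      using r(2)[of j] sr by (simp add: shift_mult_vec r(4) mult_right_mono)
    then show False using that r(2,3) by (auto simp: stab_def)
  qed
qed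

lemma eigenvalues_uminus: "c \<in> eigenvalues (- K) \<longleftrightarrow> - c \<in> eigenvalues K"
proof -
  have "cmat (- K) *v z = - (cmat K *v z)" and "(- c) *s z = - (c *s z)" for z
    by (simp_all add: vec_eq_iff cmat_def matrix_vector_mult_def sum_negf)
  then have "cmat (- K) *v z = c *s z \<longleftrightarrow> cmat K *v z = (- c) *s z" for z
    by (metis minus_minus)
  then show ?thesis by (simp only: eigenvalues_def mem_Collect_eq)
qed

lemma spectral_radius_uminus: "spectral_radius (- K) = spectral_radius K"
proof -
  have sub: "cmod ` eigenvalues T \<subseteq> cmod ` eigenvalues (- T)" for T :: "real^'n^'n"
  proof (rule image_subsetI)
    fix c assume "c \<in> eigenvalues T"
    then have "- c \<in> eigenvalues (- T)" by (simp add: eigenvalues_uminus)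
    then have "cmod (- c) \<in> cmod ` eigenvalues (- T)" by (rule imageI)
    then show "cmod c \<in> cmod ` eigenvalues (- T)" by simp
  qed
  have "cmod ` eigenvalues (- K) = cmod ` eigenvalues K"
    using sub[of K] sub[of "- K"] by simp
  then show ?thesis by (simp add: spectral_radius_def)
qed

subsection \<open>Nonnegative perturbations\<close>

lemma invertible_matrix_inv:
  fixes A :: "real^'n^'n"
  assumes "invertible A"
  shows "A ** matrix_inv A = mat 1" "matrix_inv A ** A = mat 1"
proof -
  have "A ** matrix_inv A = mat 1 \<and> matrix_inv A ** A = mat 1"
    unfolding matrix_inv_def by (rule someI_ex) (use assms in \<open>simp only: invertible_def\<close>)
  then show "A ** matrix_inv A = mat 1" "matrix_inv A ** A = mat 1" by blast+
qed

lemma matrix_inv_unique: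
  fixes A B :: "real^'n^'n"
  assumes "A ** B = mat 1" "B ** A = mat 1"
  shows "matrix_inv A = B"
proof -
  have "invertible A" using assms unfolding invertible_def by blast
  then have "A ** matrix_inv A = mat 1" by (rule invertible_matrix_inv)
  then have "(B ** A) ** matrix_inv A = B" by (simp only: matrix_mul_rid matrix_mul_assoc[symmetric])
  then show ?thesis by (simp only: assms(2) matrix_mul_lid)
qed

lemma nonneg_mat_mult:
  "nonneg_mat (A :: real^'n^'n) \<Longrightarrow> nonneg_mat B \<Longrightarrow> nonneg_mat (A ** B)"
  by (simp add: nonneg_mat_def matrix_matrix_mult_def sum_nonneg)

lemma matrix_minus_mult: "(- A) ** B = - (A ** (B :: real^'n^'n))" "A ** (- B) = - (A ** B)"
  for A :: "real^'n^'n"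
  by (simp_all add: vec_eq_iff matrix_matrix_mult_def sum_negf)

lemma matrix_minus_mult_vec: "(- A) *v x = - (A *v (x :: real^'n))"
  by (simp add: vec_eq_iff matrix_vector_mult_def sum_negf)

lemma mult_vec_minus: "A *v (- x) = - (A *v (x :: real^'n))"
  by (simp add: vec_eq_iff matrix_vector_mult_def sum_negf)

lemma vec_mult_minus: "x v* (- A) = - ((x :: real^'n) v* A)"
  by (simp add: vec_eq_iff vector_matrix_mult_def sum_negf)

lemma shift_mult_left:
  fixes A K :: "real^'n^'n"
  shows "(K - l *\<^sub>R mat 1) ** A = K ** A - l *\<^sub>R A"
  by (simp add: matrix_eq shift_mult_vec matrix_vector_mul_assoc[symmetric]
      matrix_vector_mult_diff_rdistrib scaleR_matrix_vector_assoc[symmetric])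

lemma shift_mult_right:
  fixes A K :: "real^'n^'n"
  shows "A ** (K - l *\<^sub>R mat 1) = A ** K - l *\<^sub>R A"
  by (simp add: matrix_eq shift_mult_vec matrix_vector_mul_assoc[symmetric] matrix_vector_mult_scaleR
      matrix_vector_mult_diff_rdistrib matrix_vector_mult_diff_distrib scaleR_matrix_vector_assoc[symmetric])

text \<open>Column \<open>j\<close> of the negated inverse solves
  \<open>T *v x = - axis j 1\<close>, and inverse positivity applies to it.\<close>

lemma nonneg_mat_neg_inverse:
  fixes T :: "real^'n^'n"
  assumes "metzler T" "stab T"
  shows "nonneg_mat (- matrix_inv T)"
  unfolding nonneg_mat_def
proof (intro allI)
  fix i j
  have "T *v (- matrix_inv T *v axis j 1) = - axis j 1"
    using invertible_matrix_inv[OF stab_invertible[OF assms]]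
    by (simp only: matrix_minus_mult_vec mult_vec_minus matrix_vector_mul_assoc) simp
  then have "0 \<le> (- matrix_inv T *v axis j 1) $ i"
    by (intro stab_inverse_pos[OF assms]) (simp add: axis_def)
  then show "0 \<le> (- matrix_inv T) $ i $ j" by (simp add: matrix_vector_mult_basis column_def)
qed

text \<open>With \<open>K = B ** - matrix_inv A0\<close> one has
  \<open>(K - I) ** A0 = - (A0 + B)\<close>. The shift is written \<open>1 *\<^sub>R mat 1\<close>
  to match the lemmas on general shifts.\<close>

lemma stab_add_iff_left:
  fixes A0 B :: "real^'n^'n"
  assumes A0: "metzler A0" and B: "nonneg_mat B"
  shows "stab (A0 + B) \<longleftrightarrow> stab A0 \<and> stab (B ** - matrix_inv A0 - 1 *\<^sub>R mat 1)"
proof -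
  have AB: "metzler (A0 + B)" using A0 B by (simp add: metzler_def nonneg_mat_def)
  have le: "stab A0" if "stab (A0 + B)"
    using stab_mono[OF A0 AB _ that] B by (simp add: nonneg_mat_def)
  show ?thesis
  proof (cases "stab A0")
    case True
    note A0s = A0 True
    define K where "K = B ** - matrix_inv A0"
    have K: "metzler (K - 1 *\<^sub>R mat 1)"
      using nonneg_mat_mult[OF B nonneg_mat_neg_inverse[OF A0s]]
      by (simp add: K_def nonneg_imp_metzler del: scaleR_one)
    have KA: "(K - 1 *\<^sub>R mat 1) ** A0 = - (A0 + B)"
      by (simp only: shift_mult_left) (simp add: K_def matrix_minus_mult matrix_mul_assoc[symmetric]
          invertible_matrix_inv[OF stab_invertible[OF A0s]])
    have "stab (A0 + B)" if st: "stab (K - 1 *\<^sub>R mat 1)"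
      unfolding stab_def
    proof (intro allI impI)
      fix w :: "real^'n"
      assume w: "(\<forall>j. 0 \<le> w$j) \<and> (\<forall>j. 0 \<le> ((A0 + B) *v w)$j)"
      have "(K - 1 *\<^sub>R mat 1) *v (A0 *v w) = - ((A0 + B) *v w)"
        by (simp only: matrix_vector_mul_assoc KA matrix_minus_mult_vec)
      then have "0 \<le> (A0 *v w)$j" for j
        using stab_inverse_pos[OF K st, of "A0 *v w"] w by simp
      then show "w = 0" using True w by (auto simp: stab_def)
    qed
    moreover have "stab (K - 1 *\<^sub>R mat 1)" if st: "stab (A0 + B)"
    proof -
      obtain v where v: "\<And>j. 0 < v$j" "\<And>j. (v v* (A0 + B))$j < 0"
        using stab_imp_left[OF st] by blast
      \<comment> \<open>The left witness \<open>v\<close> of \<open>A0 + B\<close> also serves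
        \<open>K - I\<close>: inverse positivity of the transpose of \<open>A0\<close> shows that
        \<open>- p\<close> is positive.\<close>
      define p where "p = v v* (K - 1 *\<^sub>R mat 1)"
      have "p v* A0 = - (v v* (A0 + B))"
        by (simp only: p_def vector_matrix_mul_assoc KA vec_mult_minus)
      then have "transpose A0 *v (- p) = v v* (A0 + B)"
        by (simp add: mult_vec_minus)
      then have "0 < (- p)$j" for j
        using A0s v(2) by (intro stab_inverse_strict_pos[of "transpose A0"]) (auto simp: stab_transpose)
      then show ?thesis using v(1) by (intro stab_if_left[of v]) (auto simp: p_def)
    qed
    ultimately show ?thesis using le by (auto simp: K_def)
  qed (use le in auto)
qed

text \<open>Here \<open>K\<close> has its factors in the other order, so the factorisation is
  \<open>A0 ** (K - I) = - (A0 + B)\<close> and right witnesses take the place of left ones.\<close>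

lemma stab_add_iff_right:
  fixes A0 B :: "real^'n^'n"
  assumes A0: "metzler A0" and B: "nonneg_mat B"
  shows "stab (A0 + B) \<longleftrightarrow> stab A0 \<and> stab (- matrix_inv A0 ** B - 1 *\<^sub>R mat 1)"
proof -
  have AB: "metzler (A0 + B)" using A0 B by (simp add: metzler_def nonneg_mat_def)
  have le: "stab A0" if "stab (A0 + B)"
    using stab_mono[OF A0 AB _ that] B by (simp add: nonneg_mat_def)
  show ?thesis
  proof (cases "stab A0")
    case True
    note A0s = A0 True
    define K where "K = - matrix_inv A0 ** B"
    have K: "metzler (K - 1 *\<^sub>R mat 1)"
      using nonneg_mat_mult[OF nonneg_mat_neg_inverse[OF A0s] B]
      by (simp add: K_def nonneg_imp_metzler del: scaleR_one)
    have AK: "A0 ** (K - 1 *\<^sub>R mat 1) = - (A0 + B)"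
      by (simp only: shift_mult_right) (simp add: K_def matrix_minus_mult matrix_mul_assoc
          invertible_matrix_inv[OF stab_invertible[OF A0s]])
    have A0K: "A0 *v ((K - 1 *\<^sub>R mat 1) *v x) = - ((A0 + B) *v x)" for x
      by (simp only: matrix_vector_mul_assoc AK matrix_minus_mult_vec)
    have "stab (A0 + B)" if st: "stab (K - 1 *\<^sub>R mat 1)"
    proof -
      obtain y where y: "\<And>j. 0 < y$j" "A0 *v y = - 1" using stab_imp_right_one[OF A0s] by blast
      \<comment> \<open>Solving with \<open>A0\<close> and then with \<open>K - I\<close> inverts
        the factorisation, so that \<open>(A0 + B) *v x = - 1\<close>.\<close>
      obtain x where x: "(K - 1 *\<^sub>R mat 1) *v x = - y" using stab_solve[OF K st] by blast
      have "0 < x$j" for j using x y(1) by (intro stab_inverse_strict_pos[OF K st]) auto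
      moreover have "(A0 + B) *v x = - 1" using A0K[of x] unfolding x mult_vec_minus y(2) by (metis minus_minus)
      ultimately show ?thesis by (intro stab_if_right[OF AB]) auto
    qed
    moreover have "stab (K - 1 *\<^sub>R mat 1)" if st: "stab (A0 + B)"
    proof -
      obtain x where x: "\<And>j. 0 < x$j" "(A0 + B) *v x = - 1"
        using stab_imp_right_one[OF AB st] by blast
      have "0 < (- ((K - 1 *\<^sub>R mat 1) *v x))$j" for j
        by (rule stab_inverse_strict_pos[OF A0s]) (simp only: mult_vec_minus A0K x(2), simp)
      then show ?thesis using x(1) K by (intro stab_if_right[of _ x]) auto
    qed
    ultimately show ?thesis using le by (auto simp: K_def)
  qed (use le in auto)
qed

subsection \<open>Diagonal Lyapunov inequality\<close>

text \<open>Substituting \<open>y = x a\<close> coordinatewise makes the off-diagonal coefficients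
  \<open>S$i$j * x$i * x$j\<close> nonnegative, so \<open>a i * a j\<close> may be replaced by the
  mean of the squares. By symmetry the double sum collapses to a combination of the negative numbers
  \<open>(S *v x)$i\<close> with weights \<open>x$i * (a i)\<^sup>2\<close>.\<close>

lemma neg_definite_if_symmetric_metzler:
  fixes S :: "real^'n^'n"
  assumes sym: "\<And>i j. S$i$j = S$j$i" and "metzler S"
    and x: "\<And>j. 0 < x$j" "\<And>j. (S *v x)$j < 0"
  shows "neg_definite S"
  unfolding neg_definite_def
proof (intro allI impI)
  fix y :: "real^'n" assume "y \<noteq> 0"
  define a where "a i = y$i / x$i" for i
  have y: "y$i = x$i * a i" for i using x(1)[of i] by (simp add: a_def)
  define f where "f i j = S$i$j * x$i * x$j" for i j
  have f: "f i j = f j i" for i j using sym[of i j] by (simp add: f_def)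
  have swap: "(\<Sum>i\<in>UNIV. \<Sum>j\<in>UNIV. f i j * (a j)\<^sup>2) = (\<Sum>i\<in>UNIV. \<Sum>j\<in>UNIV. f i j * (a i)\<^sup>2)"
    by (subst sum.swap) (simp add: f)
  have "y \<bullet> (S *v y) = (\<Sum>i\<in>UNIV. \<Sum>j\<in>UNIV. f i j * (a i * a j))"
    by (simp add: inner_vec_def matrix_vector_mult_def sum_distrib_left y f_def ac_simps)
  also have "\<dots> \<le> (\<Sum>i\<in>UNIV. \<Sum>j\<in>UNIV. f i j * (((a i)\<^sup>2 + (a j)\<^sup>2) / 2))"
  proof (intro sum_mono)
    fix i j
    show "f i j * (a i * a j) \<le> f i j * (((a i)\<^sup>2 + (a j)\<^sup>2) / 2)"
    proof (cases "i = j")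
      case False
      then have "0 \<le> f i j"
        using \<open>metzler S\<close> x(1) by (simp add: f_def metzler_def less_imp_le)
      moreover have "a i * a j \<le> ((a i)\<^sup>2 + (a j)\<^sup>2) / 2"
        using sum_squares_bound[of "a i" "a j"] by simp
      ultimately show ?thesis by (rule mult_left_mono[rotated])
    qed (simp add: power2_eq_square)
  qed
  also have "\<dots> = ((\<Sum>i\<in>UNIV. \<Sum>j\<in>UNIV. f i j * (a i)\<^sup>2) + (\<Sum>i\<in>UNIV. \<Sum>j\<in>UNIV. f i j * (a j)\<^sup>2)) / 2"
    by (simp add: sum.distrib[symmetric] sum_divide_distrib distrib_left add_divide_distrib)
  also have "\<dots> = (\<Sum>i\<in>UNIV. \<Sum>j\<in>UNIV. f i j * (a i)\<^sup>2)"
    by (simp add: swap)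
  also have "\<dots> = (S *v x) \<bullet> (\<chi> i. x$i * (a i)\<^sup>2)"
    by (simp add: inner_vec_def matrix_vector_mult_def sum_distrib_left sum_distrib_right f_def ac_simps)
  also have "\<dots> < 0"
  proof (rule inner_pos_neg)
    obtain k where "y$k \<noteq> 0" using \<open>y \<noteq> 0\<close> by (auto simp: vec_eq_iff)
    then have "(\<chi> i. x$i * (a i)\<^sup>2) $ k \<noteq> 0" using y[of k] by auto
    then show "(\<chi> i. x$i * (a i)\<^sup>2) \<noteq> 0" by (metis zero_index)
  qed (use x in \<open>auto simp: less_imp_le\<close>)
  finally show "y \<bullet> (S *v y) < 0" .
qed

section \<open>Diagonal matrices and entrywise rules\<close>

definition diagm :: "real^'n \<Rightarrow> real^'n^'n" where
  "diagm d = (\<chi> i j. if i = j then d$i else 0)"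

lemma diagm_mult_vec: "(diagm d *v x)$i = d$i * x$i"
  by (simp add: diagm_def matrix_vector_mult_def if_distrib[of "\<lambda>u. u * _"] cong: if_cong)

lemma diagm_mult: "(diagm d ** B)$i$j = d$i * B$i$j"
  by (simp add: diagm_def matrix_matrix_mult_def if_distrib[of "\<lambda>u. u * _"] cong: if_cong)

lemma mult_diagm: "(B ** diagm d)$i$j = B$i$j * d$j"
  by (simp add: diagm_def matrix_matrix_mult_def if_distrib[of "\<lambda>u. _ * u"] cong: if_cong)

lemma transpose_diagm: "transpose (diagm d) = diagm d"
  by (simp add: diagm_def transpose_def vec_eq_iff)

lemma pos_diag_diagm: "pos_diag P \<longleftrightarrow> (\<exists>d. P = diagm d \<and> (\<forall>i. 0 < d$i))"
proof
  assume "pos_diag P"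
  then have "P = diagm (\<chi> i. P$i$i)" "\<forall>i. 0 < (\<chi> i. P$i$i)$i"
    by (simp_all add: pos_diag_def diagm_def vec_eq_iff)
  then show "\<exists>d. P = diagm d \<and> (\<forall>i. 0 < d$i)" by blast
qed (auto simp: pos_diag_def diagm_def)

lemma matrix_inv_diagm:
  assumes "\<And>i. 0 < d$i"
  shows "matrix_inv (diagm d) = diagm (\<chi> i. inverse (d$i))"
  by (rule matrix_inv_unique; use assms in \<open>simp add: vec_eq_iff diagm_mult; simp add: diagm_def mat_def less_imp_neq[symmetric]\<close>)

lemma nonneg_mat_diagm: "(\<And>i. 0 \<le> d$i) \<Longrightarrow> nonneg_mat (diagm d)"
  by (simp add: nonneg_mat_def diagm_def)

lemma inner_transpose_mult_vec: "u \<bullet> (transpose A *v z) = (A *v u) \<bullet> (z :: real^'n)"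
  by (simp add: dot_lmul_matrix[symmetric] inner_commute)

lemma sum_mult_vec: "(\<Sum>i\<in>I. B i) *v x = (\<Sum>i\<in>I. B i *v (x :: real^'n))"
  by (induction I rule: infinite_finite_induct) (simp_all add: matrix_vector_mult_add_rdistrib)

lemma vec_mult_sum: "x v* (\<Sum>i\<in>I. B i) = (\<Sum>i\<in>I. (x :: real^'n) v* B i)"
  by (induction I rule: infinite_finite_induct) (simp_all add: vector_matrix_mult_add_rdistrib)

lemma vec_mult_scaleR: "x v* (c *\<^sub>R B) = c *\<^sub>R ((x :: real^'n) v* B)"
  by (simp add: vec_eq_iff vector_matrix_mult_def sum_distrib_left ac_simps)

lemma metzler_add: "metzler A \<Longrightarrow> metzler B \<Longrightarrow> metzler (A + B)"
  by (simp add: metzler_def)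

lemma nonneg_mat_sum: "(\<And>i. i \<in> I \<Longrightarrow> nonneg_mat (B i)) \<Longrightarrow> nonneg_mat (\<Sum>i\<in>I. B i)"
  by (simp add: nonneg_mat_def sum_nonneg)

lemma nonneg_mat_transpose: "nonneg_mat A \<Longrightarrow> nonneg_mat (transpose A)"
  by (simp add: nonneg_mat_def transpose_def)

lemma transpose_sum: "transpose (\<Sum>i\<in>I. B i) = (\<Sum>i\<in>I. transpose (B i :: real^'n^'n))"
  by (simp add: vec_eq_iff transpose_def)

lemma transpose_add: "transpose (A + B) = transpose A + transpose (B :: real^'n^'n)"
  by (simp add: vec_eq_iff transpose_def)

lemma nonneg_mat_weighted_sum:
  fixes A :: "nat \<Rightarrow> real^'n^'n"
  assumes "\<And>i. i \<in> I \<Longrightarrow> nonneg_mat (A i)" "\<And>i. i \<in> I \<Longrightarrow> 0 \<le> h i"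
  shows "nonneg_mat (\<Sum>i\<in>I. h i *\<^sub>R A i)"
  using assms by (intro nonneg_mat_sum) (simp add: nonneg_mat_def)

context
  fixes A0 :: "real^'n^'n" and A :: "nat \<Rightarrow> real^'n^'n" and h :: "nat \<Rightarrow> real" and I :: "nat set"
  assumes A0: "metzler A0" and A: "\<And>i. i \<in> I \<Longrightarrow> nonneg_mat (A i)" and h: "\<And>i. i \<in> I \<Longrightarrow> 0 \<le> h i"
begin

lemma metzler_weighted_sum: "metzler (A0 + (\<Sum>i\<in>I. h i *\<^sub>R A i))"
  using metzler_add[OF A0 nonneg_imp_metzler[OF nonneg_mat_weighted_sum[OF A h]]] .

text \<open>An unstable \<open>?M\<close> has an eigenvector \<open>w\<close> with eigenvalue
  \<open>l \<ge> 0\<close>. At \<open>w\<close> the quadratic form is at least \<open>2 * l\<close>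
  times the \<open>P\<close>-weighted square norm of \<open>w\<close>, hence not negative.\<close>

lemma stab_if_lmi:
  assumes P: "pos_diag P" and Q: "\<And>i. i \<in> I \<Longrightarrow> pos_diag (Q i)"
    and neg: "neg_definite (transpose A0 ** P + P ** A0 +
       (\<Sum>i\<in>I. Q i + (h i)\<^sup>2 *\<^sub>R (P ** A i ** matrix_inv (Q i) ** transpose (A i) ** P)))"
      (is "neg_definite ?S")
  shows "stab (A0 + (\<Sum>i\<in>I. h i *\<^sub>R A i))" (is "stab ?M")
proof (rule ccontr)
  assume unstable: "\<not> stab ?M"
  obtain l w where w: "0 \<le> l" "w \<noteq> 0" "?M *v w = l *\<^sub>R w"
    by (rule unstable_kernel[OF metzler_weighted_sum unstable])
  obtain p where p: "P = diagm p" "\<And>i. 0 < p$i" using P by (auto simp: pos_diag_diagm)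
  have Psym: "u \<bullet> (P *v z) = (P *v u) \<bullet> z" for u z
    using inner_transpose_mult_vec[of u P z] by (simp only: p(1) transpose_diagm)
  txt \<open>AM-GM with the weights of \<open>Q i\<close>, where \<open>y\<close> is the transpose of \<open>P ** A i\<close> applied to \<open>w\<close>:
    \<open>2 h y\<^sub>k w\<^sub>k \<le> q\<^sub>k w\<^sub>k\<^sup>2 + h\<^sup>2 y\<^sub>k\<^sup>2 / q\<^sub>k\<close>.\<close>
  have term_i: "2 * h i * ((A i *v w) \<bullet> (P *v w)) \<le>
      w \<bullet> ((Q i + (h i)\<^sup>2 *\<^sub>R (P ** A i ** matrix_inv (Q i) ** transpose (A i) ** P)) *v w)"
    if i: "i \<in> I" for i
  proof -
    obtain q where q: "Q i = diagm q" "\<And>i. 0 < q$i" using Q[OF i] by (auto simp: pos_diag_diagm)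
    define y where "y = (P *v w) v* A i"
    define R where "R = matrix_inv (Q i)"
    have R: "R = diagm (\<chi> i. inverse (q$i))" unfolding R_def q(1) by (rule matrix_inv_diagm[OF q(2)])
    have "w \<bullet> ((P ** A i ** R ** transpose (A i) ** P) *v w) = y \<bullet> (R *v y)"
      by (simp add: matrix_vector_mul_assoc[symmetric] Psym y_def dot_lmul_matrix)
    also have "\<dots> = (\<Sum>k\<in>UNIV. (y$k)\<^sup>2 / q$k)"
      by (simp add: R inner_vec_def diagm_mult_vec power2_eq_square divide_inverse ac_simps)
    finally have yR: "w \<bullet> ((P ** A i ** R ** transpose (A i) ** P) *v w) = (\<Sum>k\<in>UNIV. (y$k)\<^sup>2 / q$k)" .
    have "2 * h i * ((A i *v w) \<bullet> (P *v w)) = 2 * h i * (y \<bullet> w)"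
      unfolding y_def dot_lmul_matrix by (simp add: inner_commute)
    also have "\<dots> = (\<Sum>k\<in>UNIV. 2 * h i * y$k * w$k)"
      by (simp add: inner_vec_def sum_distrib_left ac_simps)
    also have "\<dots> \<le> (\<Sum>k\<in>UNIV. q$k * (w$k)\<^sup>2 + (h i)\<^sup>2 * ((y$k)\<^sup>2 / q$k))"
    proof (rule sum_mono)
      fix k
      \<comment> \<open>Completing the square, divided by the positive weight
        \<open>q$k\<close>.\<close>
      have "0 \<le> (q$k * w$k - h i * y$k)\<^sup>2 / q$k" using q(2)[of k] by simp
      also have "\<dots> = q$k * (w$k)\<^sup>2 + (h i)\<^sup>2 * ((y$k)\<^sup>2 / q$k) - 2 * h i * y$k * w$k"
        using q(2)[of k] by (simp add: field_simps power2_eq_square)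
      finally show "2 * h i * y$k * w$k \<le> q$k * (w$k)\<^sup>2 + (h i)\<^sup>2 * ((y$k)\<^sup>2 / q$k)" by simp
    qed
    also have "\<dots> = w \<bullet> (Q i *v w) + (h i)\<^sup>2 * (\<Sum>k\<in>UNIV. (y$k)\<^sup>2 / q$k)"
      by (simp add: q(1) inner_vec_def diagm_mult_vec sum.distrib sum_distrib_left power2_eq_square ac_simps)
    also have "\<dots> = w \<bullet> ((Q i + (h i)\<^sup>2 *\<^sub>R (P ** A i ** R ** transpose (A i) ** P)) *v w)"
      by (simp only: matrix_vector_mult_add_rdistrib scaleR_matrix_vector_assoc[symmetric]
          inner_add_right inner_scaleR_right yR)
    finally show ?thesis by (simp only: R_def)
  qed
  have "w \<bullet> ((transpose A0 ** P) *v w) = (A0 *v w) \<bullet> (P *v w)"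
    by (simp only: matrix_vector_mul_assoc[symmetric] inner_transpose_mult_vec)
  moreover have "w \<bullet> ((P ** A0) *v w) = (A0 *v w) \<bullet> (P *v w)"
    unfolding matrix_vector_mul_assoc[symmetric] using Psym[of w "A0 *v w"] by (simp add: inner_commute)
  ultimately have "w \<bullet> (?S *v w) = 2 * ((A0 *v w) \<bullet> (P *v w)) + (\<Sum>i\<in>I.
      w \<bullet> ((Q i + (h i)\<^sup>2 *\<^sub>R (P ** A i ** matrix_inv (Q i) ** transpose (A i) ** P)) *v w))"
    by (simp only: matrix_vector_mult_add_rdistrib[of "_ + _"] matrix_vector_mult_add_rdistrib[of "transpose _ ** _"]
        sum_mult_vec inner_add_right inner_sum_right)
  also have "\<dots> \<ge> 2 * ((A0 *v w) \<bullet> (P *v w)) + (\<Sum>i\<in>I. 2 * h i * ((A i *v w) \<bullet> (P *v w)))"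
    using term_i by (intro add_left_mono sum_mono)
  also have "2 * ((A0 *v w) \<bullet> (P *v w)) + (\<Sum>i\<in>I. 2 * h i * ((A i *v w) \<bullet> (P *v w))) = 2 * ((?M *v w) \<bullet> (P *v w))"
    by (simp add: matrix_vector_mult_add_rdistrib sum_mult_vec scaleR_matrix_vector_assoc[symmetric]
        inner_add_left inner_sum_left sum_distrib_left mult.assoc)
  also have "\<dots> = 2 * l * (\<Sum>i\<in>UNIV. p$i * (w$i)\<^sup>2)"
    by (simp add: w(3) p(1) inner_vec_def diagm_mult_vec power2_eq_square sum_distrib_left ac_simps)
  finally have "2 * l * (\<Sum>i\<in>UNIV. p$i * (w$i)\<^sup>2) \<le> w \<bullet> (?S *v w)" .
  moreover have "0 \<le> 2 * l * (\<Sum>i\<in>UNIV. p$i * (w$i)\<^sup>2)"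
    using w(1) p(2) by (intro mult_nonneg_nonneg sum_nonneg) (auto simp: less_imp_le)
  moreover have "w \<bullet> (?S *v w) < 0"
    using neg w(2) by (simp add: neg_definite_def)
  ultimately show False by linarith
qed

text \<open>With positive \<open>v\<close>, \<open>x\<close> such that \<open>v v* M < 0\<close> and \<open>M *v x < 0\<close>, take \<open>P x = v\<close> and
  \<open>Q i x = h i (v v* A i) + e x\<close>. Then the (Metzler and symmetric) left-hand side of the
  inequality maps \<open>x\<close> below \<open>v v* M + P (M x) + card I e x\<close>, which is negative for small \<open>e\<close>.\<close>

lemma lmi_if_stab:
  assumes "stab (A0 + (\<Sum>i\<in>I. h i *\<^sub>R A i))" (is "stab ?M")
  obtains P Q where "pos_diag P" "\<And>i. i \<in> I \<Longrightarrow> pos_diag (Q i)"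
    "neg_definite (transpose A0 ** P + P ** A0 +
       (\<Sum>i\<in>I. Q i + (h i)\<^sup>2 *\<^sub>R (P ** A i ** matrix_inv (Q i) ** transpose (A i) ** P)))"
proof -
  have met: "metzler ?M" by (rule metzler_weighted_sum)
  obtain v where v: "\<And>j. 0 < v$j" "\<And>j. (v v* ?M)$j < 0"
    using stab_imp_left[OF assms] by blast
  obtain x where x: "\<And>j. 0 < x$j" "?M *v x = - 1"
    using stab_imp_right_one[OF met assms] by blast
  define p where "p = (\<chi> j. v$j / x$j)"
  define P where "P = diagm p"
  have p0: "0 < p$j" for j using v(1) x(1) by (simp add: p_def)
  have Px: "P *v x = v"
    using x(1) by (simp add: vec_eq_iff P_def diagm_mult_vec p_def less_imp_neq[symmetric])
  \<comment> \<open>Upper bound for \<open>S *v x\<close> below. Each \<open>Q i\<close> contributes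
    one summand \<open>e x\<close>, hence the factor \<open>card I\<close>; at \<open>e = 0\<close>
    it is \<open>v v* ?M - p\<close>, which is negative.\<close>
  define F where "F e = v v* ?M + P *v (?M *v x) + (real (card I) * e) *\<^sub>R x" for e
  have "(F \<longlongrightarrow> v v* ?M + P *v (?M *v x) + (real (card I) * 0) *\<^sub>R x) (at_right 0)"
    unfolding F_def by (intro tendsto_intros)
  moreover have "(v v* ?M + P *v (?M *v x) + (real (card I) * 0) *\<^sub>R x)$j < 0" for j
    unfolding x(2) using v(2)[of j] p0[of j] by (simp add: P_def diagm_mult_vec add_neg_neg)
  ultimately have "eventually (\<lambda>e. \<forall>j. F e $ j < 0) (at_right 0)"
    by (rule eventually_vec_neg)
  moreover have "eventually (\<lambda>e. 0 < e) (at_right (0::real))"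
    by (simp add: eventually_at_right_less)
  ultimately have "eventually (\<lambda>e. 0 < e \<and> (\<forall>j. F e $ j < 0)) (at_right 0)"
    by eventually_elim auto
  then obtain e where e: "0 < e" "\<And>j. F e $ j < 0"
    using eventually_happens'[OF trivial_limit_at_right_real] by blast
  \<comment> \<open>The summand \<open>e\<close> keeps the entry positive where \<open>h i\<close>
    or \<open>(v v* A i)$k\<close> vanishes, so that \<open>Q i\<close> stays invertible.\<close>
  define q where "q i = (\<chi> k. h i * (v v* A i)$k / x$k + e)" for i
  define Q where "Q i = diagm (q i)" for i
  have vA: "0 \<le> (v v* A i)$k" if "i \<in> I" for i k
    using A[OF that] v(1) by (auto simp: vector_matrix_mult_def nonneg_mat_def less_imp_le intro!: sum_nonneg)
  have q0: "0 < q i $ k" if "i \<in> I" for i k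
    using vA[OF that, of k] h[OF that] x(1)[of k] e(1) by (simp add: q_def add_nonneg_pos)
  have qx: "q i $ k * x$k = h i * (v v* A i)$k + e * x$k" for i k
    using x(1)[of k] by (simp add: q_def field_simps)
  have Qinv: "matrix_inv (Q i) = diagm (\<chi> k. inverse (q i $ k))" if "i \<in> I" for i
    unfolding Q_def using matrix_inv_diagm[OF q0[OF that]] .
  define B where "B i = P ** A i ** matrix_inv (Q i) ** transpose (A i) ** P" for i
  define S where "S = transpose A0 ** P + P ** A0 + (\<Sum>i\<in>I. Q i + (h i)\<^sup>2 *\<^sub>R B i)"
  have B0: "nonneg_mat (B i)" if "i \<in> I" for i
    unfolding B_def Qinv[OF that] P_def
    using A[OF that] p0 q0[OF that]
    by (intro nonneg_mat_mult nonneg_mat_diagm nonneg_mat_transpose) (auto intro: less_imp_le)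
  have p0': "0 \<le> p$j" for j using p0[of j] by simp
  have "metzler (transpose A0 ** P)" "metzler (P ** A0)"
    unfolding metzler_def P_def mult_diagm diagm_mult
    using A0 p0' by (auto simp: metzler_def transpose_def intro!: mult_nonneg_nonneg)
  moreover have "nonneg_mat (\<Sum>i\<in>I. Q i + (h i)\<^sup>2 *\<^sub>R B i)"
  proof (rule nonneg_mat_sum)
    fix i assume i: "i \<in> I"
    have "nonneg_mat (Q i)"
      unfolding Q_def using q0[OF i] by (intro nonneg_mat_diagm less_imp_le)
    then show "nonneg_mat (Q i + (h i)\<^sup>2 *\<^sub>R B i)"
      using B0[OF i] by (simp add: nonneg_mat_def)
  qed
  ultimately have "metzler S"
    unfolding S_def by (intro metzler_add[OF metzler_add nonneg_imp_metzler])
  moreover have "transpose S = S"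
  proof -
    have "transpose (B i) = B i" if "i \<in> I" for i
      by (simp add: B_def Qinv[OF that] P_def matrix_transpose_mul transpose_diagm matrix_mul_assoc)
    then show ?thesis
      by (simp add: S_def transpose_add transpose_sum transpose_scalar matrix_transpose_mul
          Q_def P_def transpose_diagm)
  qed
  then have "S$i$j = S$j$i" for i j
  proof -
    have "S$i$j = transpose S $ j $ i" by (simp add: transpose_def)
    then show ?thesis by (simp only: \<open>transpose S = S\<close>)
  qed
  moreover have "(S *v x)$j < 0" for j
  proof -
    have i: "((Q i + (h i)\<^sup>2 *\<^sub>R B i) *v x)$j \<le> h i * (v v* A i)$j + p$j * (h i * (A i *v x)$j) + e * x$j"
      if "i \<in> I" for i
    proof -
      \<comment> \<open>Since \<open>Q i *v x\<close> dominates
        \<open>h i *\<^sub>R (v v* A i)\<close>, one gets \<open>h i *\<^sub>R z \<le> x\<close>.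
        This turns the term quadratic in \<open>h i\<close> into one linear in
        \<open>h i\<close>.\<close>
      define z where "z = matrix_inv (Q i) *v (v v* A i)"
      have "h i * z$k \<le> x$k" for k
      proof -
        have "h i * (v v* A i)$k \<le> q i $ k * x$k" using qx[of i k] e(1) x(1)[of k] by simp
        then show ?thesis
          using q0[OF that, of k] by (simp add: z_def Qinv[OF that] diagm_mult_vec field_simps)
      qed
      then have "(A i *v (h i *\<^sub>R z))$j \<le> (A i *v x)$j"
        using A[OF that] by (auto simp: matrix_vector_mult_def nonneg_mat_def intro!: sum_mono mult_left_mono)
      then have "h i * (A i *v z)$j \<le> (A i *v x)$j" by (simp add: matrix_vector_mult_scaleR)
      then have "(h i * p$j) * (h i * (A i *v z)$j) \<le> (h i * p$j) * (A i *v x)$j"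
        using h[OF that] p0[of j] by (intro mult_left_mono) auto
      moreover have "(B i *v x)$j = p$j * (A i *v z)$j"
        unfolding B_def matrix_vector_mul_assoc[symmetric] Px
        by (simp add: P_def diagm_mult_vec z_def)
      moreover have "(Q i *v x)$j = h i * (v v* A i)$j + e * x$j"
        by (simp add: Q_def diagm_mult_vec qx)
      ultimately show ?thesis
        by (simp add: matrix_vector_mult_add_rdistrib scaleR_matrix_vector_assoc[symmetric]
            power2_eq_square ac_simps)
    qed
    have "(S *v x)$j = (v v* A0)$j + p$j * (A0 *v x)$j + (\<Sum>i\<in>I. ((Q i + (h i)\<^sup>2 *\<^sub>R B i) *v x)$j)"
      unfolding S_def
      by (simp only: matrix_vector_mult_add_rdistrib[of "_ + _"] matrix_vector_mult_add_rdistrib[of "transpose _ ** _"]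
          sum_mult_vec vector_add_component sum_component matrix_vector_mul_assoc[symmetric] Px transpose_matrix_vector)
        (simp add: P_def diagm_mult_vec)
    also have "\<dots> \<le> (v v* A0)$j + p$j * (A0 *v x)$j +
        (\<Sum>i\<in>I. h i * (v v* A i)$j + p$j * (h i * (A i *v x)$j) + e * x$j)"
      using i by (intro add_left_mono sum_mono)
    also have "\<dots> = F e $ j"
      by (simp add: F_def P_def diagm_mult_vec matrix_vector_mult_add_rdistrib vector_matrix_mult_add_rdistrib
          sum_mult_vec vec_mult_sum vec_mult_scaleR scaleR_matrix_vector_assoc[symmetric]
          sum.distrib sum_distrib_left distrib_left ac_simps)
    also have "\<dots> < 0" by (rule e(2))
    finally show ?thesis .
  qed
  ultimately have "neg_definite S"
    using x(1) by (intro neg_definite_if_symmetric_metzler) auto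
  moreover have "pos_diag P" "\<And>i. i \<in> I \<Longrightarrow> pos_diag (Q i)"
    using p0 q0 by (auto simp: pos_diag_diagm P_def Q_def)
  ultimately show thesis by (intro that[of P Q]) (auto simp: S_def B_def)
qed

end

subsection \<open>The delay equation\<close>

text \<open>Equal to \<open>(1 - exp (- h * l)) / l\<close> for \<open>l \<noteq> 0\<close>. The
  integral form also covers \<open>l = 0\<close> and makes continuity there immediate.\<close>

definition gain :: "real \<Rightarrow> real \<Rightarrow> real" where
  "gain h l = integral {-h..0} (\<lambda>s. exp (l * s))"

lemma exp_integrable: "(\<lambda>s. exp (l * s) :: real) integrable_on {a..b}"
  by (intro integrable_continuous_interval continuous_intros)

lemma integral_exp_shift:
  assumes "0 \<le> h"
  shows "integral {t - h..t} (\<lambda>s. exp (l * s)) = exp (l * t) * gain h l"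
proof -
  have FTC: "integral {a..b} (\<lambda>s. exp (l * s)) = (exp (l * b) - exp (l * a)) / l" if "l \<noteq> 0" "a \<le> b" for a b
  proof (rule integral_unique)
    have "((\<lambda>s. exp (l * s)) has_integral exp (l * b) / l - exp (l * a) / l) {a..b}"
      using that by (intro fundamental_theorem_of_calculus)
        (auto intro!: derivative_eq_intros simp: has_real_derivative_iff_has_vector_derivative[symmetric])
    then show "((\<lambda>s. exp (l * s)) has_integral (exp (l * b) - exp (l * a)) / l) {a..b}"
      by (simp add: diff_divide_distrib)
  qed
  show ?thesis
  proof (cases "l = 0")
    case False
    have "exp (l * (t - h)) = exp (l * t) * exp (l * - h)"
      by (simp add: exp_add[symmetric] algebra_simps)
    then have "(exp (l * t) - exp (l * (t - h))) / l = exp (l * t) * ((exp (l * 0) - exp (l * - h)) / l)"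
      by (simp add: right_diff_distrib[of "exp (l * t)"])
    then show ?thesis
      using FTC[OF False, of "t - h" t] FTC[OF False, of "- h" 0] assms by (simp add: gain_def)
  qed (use assms in \<open>simp add: gain_def\<close>)
qed

lemma gain_zero: "0 \<le> h \<Longrightarrow> gain h 0 = h"
  by (simp add: gain_def)

lemma gain_nonneg: "0 \<le> gain h l"
  unfolding gain_def by (rule integral_nonneg) (simp_all add: exp_integrable)

lemma gain_le:
  assumes "0 \<le> h" "0 \<le> l"
  shows "gain h l \<le> h"
proof -
  have "gain h l \<le> integral {-h..0} (\<lambda>s. 1)"
    unfolding gain_def
    using assms by (intro integral_le exp_integrable) (auto simp: mult_nonneg_nonpos)
  then show ?thesis using assms by simp
qed

lemma continuous_on_gain: "continuous_on S (gain h)"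
proof -
  have "continuous_on S (\<lambda>l. integral (cbox (-h) 0) (\<lambda>s. exp (l * s)))"
    by (rule integral_continuous_on_param) (auto intro!: continuous_intros simp: split_beta)
  then show ?thesis by (simp add: gain_def[abs_def])
qed

text \<open>For moving a sign \<open>s\<close> through a nonnegative matrix: \<open>s\<close> may be
  negative, so the bound is assumed for the product \<open>s * u$k\<close>.\<close>

lemma scaled_mult_vec_le:
  fixes B :: "real^'n^'n"
  assumes "nonneg_mat B" "\<And>k. s * u$k \<le> z$k"
  shows "s * (B *v u)$j \<le> (B *v z)$j"
  using assms unfolding nonneg_mat_def matrix_vector_mult_def
  by (simp add: sum_distrib_left mult.left_commute[of s] sum_mono mult_left_mono)

locale delay_system =
  fixes A0 :: "real^'n^'n" and A :: "nat \<Rightarrow> real^'n^'n" and N :: nat and hbar :: "nat \<Rightarrow> real"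
  assumes A0: "metzler A0" and A: "\<And>i. i \<in> {1..N} \<Longrightarrow> nonneg_mat (A i)"
    and hbar: "\<And>i. i \<in> {1..N} \<Longrightarrow> 0 \<le> hbar i"
begin

text \<open>\<open>t \<mapsto> exp (l t) v\<close> solves the equation with constant maximal delays iff
  \<open>exp_mat l *v v = l v\<close>.\<close>

definition exp_mat :: "real \<Rightarrow> real^'n^'n" where
  "exp_mat l = A0 + (\<Sum>i\<in>{1..N}. gain (hbar i) l *\<^sub>R A i)"

lemma exp_mat_zero: "exp_mat 0 = A0 + (\<Sum>i\<in>{1..N}. hbar i *\<^sub>R A i)"
  by (simp add: exp_mat_def gain_zero hbar)

lemma metzler_exp_mat: "metzler (exp_mat l)"
  unfolding exp_mat_def by (rule metzler_weighted_sum) (auto simp: A0 A gain_nonneg)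

lemma continuous_on_exp_mat: "continuous_on S exp_mat"
  unfolding exp_mat_def[abs_def] by (intro continuous_intros continuous_on_gain)

lemma exp_mat_le: "0 \<le> l \<Longrightarrow> exp_mat l $ i $ j \<le> exp_mat 0 $ i $ j"
  unfolding exp_mat_def using A hbar
  by (auto simp: nonneg_mat_def gain_zero intro!: sum_mono mult_right_mono gain_le)

lemma exp_mat_mult_vec:
  "exp_mat l *v u = A0 *v u + (\<Sum>i\<in>{1..N}. gain (hbar i) l *\<^sub>R (A i *v u))"
  by (simp add: exp_mat_def matrix_vector_mult_add_rdistrib sum_mult_vec scaleR_matrix_vector_assoc[symmetric])

text \<open>For \<open>l \<ge> 0\<close> the gains are at most the maximal delays, so
  \<open>exp_mat l\<close> lies below \<open>exp_mat 0\<close> entrywise and a shift that stabilises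
  \<open>exp_mat 0\<close> stabilises it too. This gives the upper end for the continuation in
  \<open>l\<close>.\<close>

lemma unstable_exp_mat_kernel:
  assumes "\<not> stab (exp_mat 0)"
  obtains l v where "0 \<le> l" "v \<noteq> 0" "exp_mat l *v v = l *\<^sub>R v"
proof -
  define b where "b = (\<Sum>i\<in>UNIV. \<Sum>j\<in>UNIV. \<bar>exp_mat 0 $i$j\<bar>) + 1"
  obtain l v where *: "0 \<le> l" "v \<noteq> 0" "(exp_mat l - l *\<^sub>R mat 1) *v v = 0"
  proof (rule kernel_at_largest_unstable[of 0 "\<lambda>l. exp_mat l - l *\<^sub>R mat 1" b])
    show "stab (exp_mat l - l *\<^sub>R mat 1)" if "b \<le> l" for l
    proof (rule stab_mono)
      have "0 \<le> b" unfolding b_def by (intro add_nonneg_nonneg sum_nonneg) auto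
      then show "(exp_mat l - l *\<^sub>R mat 1) $ i $ j \<le> (exp_mat 0 - l *\<^sub>R mat 1) $ i $ j" for i j
        using exp_mat_le[of l i j] that by simp
      show "stab (exp_mat 0 - l *\<^sub>R mat 1)"
        using that by (intro stab_shift_large metzler_exp_mat) (simp add: b_def)
    qed (simp_all add: metzler_exp_mat)
  qed (use assms in \<open>auto intro!: continuous_intros continuous_on_exp_mat simp: metzler_exp_mat\<close>)
  then show thesis by (intro that[of l v]) (auto simp: shift_mult_vec)
qed

text \<open>The exponential satisfies the equation on the whole line, so the history length
  \<open>H\<close> is free.\<close>

lemma exp_solution:
  assumes eig: "exp_mat l *v v = l *\<^sub>R v"
  shows "dd_solution A0 A N H (\<lambda>i t. hbar i) (\<lambda>t. exp (l * t) *\<^sub>R v)"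
proof -
  let ?x = "\<lambda>t. exp (l * t) *\<^sub>R v"
  have rhs: "dd_rhs A0 A N (\<lambda>i t. hbar i) ?x s = (l * exp (l * s)) *\<^sub>R v" for s
  proof -
    have "integral {s - hbar i..s} ?x = (exp (l * s) * gain (hbar i) l) *\<^sub>R v" if "i \<in> {1..N}" for i
      using integral_unique[OF has_integral_scaleR_left[OF integrable_integral[OF exp_integrable]]]
        integral_exp_shift[OF hbar[OF that]] by metis
    then have "dd_rhs A0 A N (\<lambda>i t. hbar i) ?x s = exp (l * s) *\<^sub>R (exp_mat l *v v)"
      by (simp add: dd_rhs_def exp_mat_mult_vec matrix_vector_mult_scaleR scaleR_right_distrib scaleR_sum_right)
    then show ?thesis by (simp add: eig mult.commute)
  qed
  have FTC: "((\<lambda>s. (l * exp (l * s)) *\<^sub>R v) has_integral ?x t - ?x 0) {0..t}" if "0 \<le> t" for t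
  proof (rule fundamental_theorem_of_calculus[OF that])
    fix s
    have "((\<lambda>s. exp (l * s)) has_real_derivative l * exp (l * s)) (at s within {0..t})"
      by (auto intro!: derivative_eq_intros)
    then show "(?x has_vector_derivative (l * exp (l * s)) *\<^sub>R v) (at s within {0..t})"
      by (intro has_vector_derivative_scaleR[where g = "\<lambda>_. v" and g' = 0, simplified])
  qed
  then show ?thesis
    unfolding dd_solution_def rhs[abs_def]
    by (auto simp: integral_unique[OF FTC] has_integral_integrable[OF FTC] intro!: continuous_intros)
qed

lemma stab_if_asymp_stable:
  assumes "dd_asymp_stable A0 A N H (\<lambda>i t. hbar i)"
  shows "stab (exp_mat 0)"
proof (rule ccontr)
  assume unstable: "\<not> stab (exp_mat 0)"
  obtain l v where v: "0 \<le> l" "v \<noteq> 0" "exp_mat l *v v = l *\<^sub>R v"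
    by (rule unstable_exp_mat_kernel[OF unstable])
  have "((\<lambda>t. exp (l * t) *\<^sub>R v) \<longlongrightarrow> 0) at_top"
    using assms exp_solution[OF v(3), of H] unfolding dd_asymp_stable_def by blast
  then have "((\<lambda>t. norm (exp (l * t) *\<^sub>R v)) \<longlongrightarrow> 0) at_top"
    by (rule tendsto_norm_zero)
  moreover have "eventually (\<lambda>t. norm v \<le> norm (exp (l * t) *\<^sub>R v)) at_top"
    using eventually_ge_at_top[of 0]
  proof eventually_elim
    fix t :: real assume "0 \<le> t"
    then have "1 \<le> exp (l * t)" using v(1) by simp
    then show "norm v \<le> norm (exp (l * t) *\<^sub>R v)"
      using mult_right_mono[of 1 "exp (l * t)" "norm v"] by simp
  qed
  ultimately have "norm v \<le> 0"
    by (rule tendsto_lowerbound) simp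
  with v(2) show False by simp
qed

text \<open>At the first time \<open>t1\<close> where some \<open>\<bar>x\<^sub>j\<bar>\<close> meets the exponential bound, the right-hand side
  stays strictly below the slope of the bound on a left neighbourhood of \<open>t1\<close>. Integrating over
  this neighbourhood contradicts the choice of \<open>t1\<close>; no differentiability of \<open>x\<close> is needed.\<close>

lemma comparison:
  assumes sol: "dd_solution A0 A N H h x"
    and h: "\<And>i t. i \<in> {1..N} \<Longrightarrow> 0 \<le> t \<Longrightarrow> 0 \<le> h i t \<and> h i t \<le> hbar i"
    and H: "0 \<le> H" "\<And>i. i \<in> {1..N} \<Longrightarrow> hbar i \<le> H"
    and w: "\<And>j. 0 < w$j" "\<And>j. (exp_mat l *v w)$j < l * w$j"
    and C: "0 < C"
    and init: "\<And>s j. -H \<le> s \<Longrightarrow> s \<le> 0 \<Longrightarrow> \<bar>x s $ j\<bar> < C * exp (l * s) * w$j"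
    and t: "0 \<le> t"
  shows "\<bar>x t $ j\<bar> < C * exp (l * t) * w$j"
proof (rule ccontr)
  assume neg: "\<not> \<bar>x t $ j\<bar> < C * exp (l * t) * w$j"
  define y where "y s = (C * exp (l * s)) *\<^sub>R w" for s
  define r where "r = dd_rhs A0 A N h x"
  have xcont: "continuous_on {-H..} x" using sol by (simp add: dd_solution_def)
  have rint: "r integrable_on {0..t}" and xeq: "x t = x 0 + integral {0..t} r" if "0 \<le> t" for t
    using sol that unfolding dd_solution_def r_def by blast+
  have xnth: "continuous_on S (\<lambda>s. x s $ k)" if "S \<subseteq> {-H..}" for S k
    using continuous_on_subset[OF xcont that] by (intro continuous_intros)
  \<comment> \<open>A finite union of closed sets, so the infimum \<open>t1\<close> is itself a time
    of violation.\<close>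
  define Bad where "Bad = (\<Union>j. {t \<in> {0..}. y t $ j \<le> \<bar>x t $ j\<bar>})"
  have "closed Bad"
    unfolding Bad_def
  proof (intro closed_UN ballI continuous_on_closed_Collect_le continuous_on_rabs xnth)
    show "continuous_on {0..} (\<lambda>t. y t $ j)" for j
      unfolding y_def by (intro continuous_intros)
  qed (use H(1) in auto)
  moreover have "t \<in> Bad" using neg t by (auto simp: Bad_def y_def not_less)
  moreover have bdd: "bdd_below Bad" by (auto simp: Bad_def intro!: bdd_belowI[of _ 0])
  define t1 where "t1 = Inf Bad"
  ultimately have "t1 \<in> Bad"
    unfolding t1_def using bdd by (intro closed_contains_Inf) auto
  then obtain j where j: "0 \<le> t1" "y t1 $ j \<le> \<bar>x t1 $ j\<bar>" by (auto simp: Bad_def)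
  have "t1 \<noteq> 0" using j(2) init[of 0 j] H(1) by (auto simp: y_def)
  then have t1: "0 < t1" using j(1) by simp
  have lt: "\<bar>x s $ k\<bar> < y s $ k" if "-H \<le> s" "s < t1" for s k
  proof (cases "s \<le> 0")
    case True
    then show ?thesis using init[of s k] that by (simp add: y_def)
  next
    case False
    have "s \<notin> Bad" using cInf_lower[OF _ bdd, of s] that by (auto simp: t1_def)
    then show ?thesis using False by (auto simp: Bad_def not_le)
  qed
  have le: "\<bar>x s $ k\<bar> \<le> y s $ k" if "-H \<le> s" "s \<le> t1" for s k
  proof (cases "s = t1")
    case True
    have cl: "closure {0..<t1} = {0..t1}" using t1 by simp
    have "0 \<le> y t1 $ k - \<bar>x t1 $ k\<bar>"
    proof (rule continuous_ge_on_closure[of "{0..<t1}" "\<lambda>s. y s $ k - \<bar>x s $ k\<bar>"])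
      show "continuous_on (closure {0..<t1}) (\<lambda>s. y s $ k - \<bar>x s $ k\<bar>)"
        unfolding cl using H(1) by (auto intro!: continuous_intros xnth simp: y_def)
      show "0 \<le> y s $ k - \<bar>x s $ k\<bar>" if "s \<in> {0..<t1}" for s
        using lt[of s k] that H(1) by auto
    qed (use t1 cl in auto)
    then show ?thesis using True by simp
  qed (use lt[of s k] that in auto)
  \<comment> \<open>The sign replaces the absolute value at \<open>t1\<close> by a fixed linear
    functional, which commutes with the integrals.\<close>
  define \<sigma> where "\<sigma> = sgn (x t1 $ j)"
  have \<sigma>: "\<bar>\<sigma>\<bar> \<le> 1" "\<sigma> * x t1 $ j = \<bar>x t1 $ j\<bar>"
    by (auto simp: \<sigma>_def sgn_if)
  have \<sigma>le: "\<sigma> * u \<le> \<bar>u\<bar>" for u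
    using mult_right_mono[OF \<sigma>(1), of "\<bar>u\<bar>"] abs_ge_self[of "\<sigma> * u"] by (simp add: abs_mult)
  \<comment> \<open>The gap to the bound in coordinate \<open>j\<close>: nonnegative up to
    \<open>t1\<close>, positive before it and nonpositive at it.\<close>
  define \<phi> where "\<phi> s = y s $ j - \<sigma> * x s $ j" for s
  have \<phi>t1: "\<phi> t1 \<le> 0" using j(2) \<sigma>(2) by (simp add: \<phi>_def)
  have \<phi>0: "0 \<le> \<phi> s" if "-H \<le> s" "s \<le> t1" for s
    using le[OF that, of j] \<sigma>le[of "x s $ j"] by (simp add: \<phi>_def)
  define \<eta> where "\<eta> = l * w$j - (exp_mat l *v w)$j"
  have \<eta>: "0 < \<eta>" using w(2)[of j] by (simp add: \<eta>_def)
  \<comment> \<open>The diagonal entry of \<open>A0\<close> has no known sign; its contribution is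
    charged to the gap \<open>\<phi> s\<close>. As the gap closes at \<open>t1\<close>, the term
    with \<open>\<eta>\<close> outweighs it nearby.\<close>
  have rhs: "\<sigma> * r s $ j \<le> \<bar>A0$j$j\<bar> * \<phi> s + C * exp (l * s) * (l * w$j - \<eta>)" if s: "0 \<le> s" "s \<le> t1" for s
  proof -
    have sH: "- H \<le> s" using s H(1) by simp
    have "\<sigma> * (A0 *v x s)$j = A0$j$j * (\<sigma> * x s $ j) + (\<Sum>k\<in>UNIV - {j}. A0$j$k * (\<sigma> * x s $ k))"
      by (simp add: matrix_vector_mult_def sum.remove[of UNIV j] sum_distrib_left algebra_simps)
    also have "\<dots> \<le> A0$j$j * (\<sigma> * x s $ j) + (\<Sum>k\<in>UNIV - {j}. A0$j$k * y s $ k)"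
    proof (intro add_left_mono sum_mono mult_left_mono)
      show "\<sigma> * x s $ k \<le> y s $ k" for k using le[OF sH s(2), of k] \<sigma>le[of "x s $ k"] by linarith
      show "0 \<le> A0$j$k" if "k \<in> UNIV - {j}" for k using A0 that by (auto simp: metzler_def)
    qed
    also have "\<dots> = (A0 *v y s)$j - A0$j$j * \<phi> s"
      by (simp add: matrix_vector_mult_def sum.remove[of UNIV j] \<phi>_def algebra_simps)
    also have "\<dots> \<le> (A0 *v y s)$j + \<bar>A0$j$j\<bar> * \<phi> s"
      using mult_right_mono[OF abs_ge_minus_self[of "A0$j$j"] \<phi>0[OF sH s(2)]] by simp
    finally have first: "\<sigma> * (A0 *v x s)$j \<le> (A0 *v y s)$j + \<bar>A0$j$j\<bar> * \<phi> s" .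
    have "\<sigma> * (A i *v integral {s - h i s..s} x)$j \<le> (A i *v (gain (hbar i) l *\<^sub>R y s))$j" if i: "i \<in> {1..N}" for i
    proof (rule scaled_mult_vec_le[OF A[OF i]])
      fix k
      have hi: "0 \<le> h i s" "h i s \<le> hbar i" "hbar i \<le> H" using h[OF i s(1)] H(2)[OF i] by auto
      have sub: "{s - h i s..s} \<subseteq> {-H..}" using hi s by auto
      have xi: "(\<lambda>u. x u $ k) integrable_on {s - h i s..s}"
        by (intro integrable_continuous_interval xnth sub)
      have "x integrable_on {s - h i s..s}"
        by (intro integrable_continuous_interval continuous_on_subset[OF xcont sub])
      then have "\<sigma> * integral {s - h i s..s} x $ k = integral {s - h i s..s} (\<lambda>u. \<sigma> * x u $ k)"
        by simp
      also have "\<dots> \<le> integral {s - h i s..s} (\<lambda>u. (C * w$k) * exp (l * u))"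
      proof (rule integral_le)
        show "\<sigma> * x u $ k \<le> (C * w$k) * exp (l * u)" if "u \<in> {s - h i s..s}" for u
          using le[of u k] \<sigma>le[of "x u $ k"] that hi s by (auto simp: y_def ac_simps)
      qed (intro integrable_on_mult_right xi exp_integrable)+
      \<comment> \<open>The dominating integrand is positive, so the window may be widened to the
        maximal delay; the actual delay disappears here.\<close>
      also have "\<dots> \<le> integral {s - hbar i..s} (\<lambda>u. (C * w$k) * exp (l * u))"
        using hi C w(1)[of k]
        by (intro integral_subset_le integrable_on_mult_right exp_integrable) auto
      also have "\<dots> = (gain (hbar i) l *\<^sub>R y s)$k"
        using integral_exp_shift[OF hbar[OF i], of s l] by (simp add: y_def ac_simps)
      finally show "\<sigma> * integral {s - h i s..s} x $ k \<le> (gain (hbar i) l *\<^sub>R y s)$k" .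
    qed
    then have "(\<Sum>i\<in>{1..N}. \<sigma> * (A i *v integral {s - h i s..s} x)$j) \<le> (\<Sum>i\<in>{1..N}. (A i *v (gain (hbar i) l *\<^sub>R y s))$j)"
      by (rule sum_mono)
    with first have "\<sigma> * r s $ j \<le> \<bar>A0$j$j\<bar> * \<phi> s + ((A0 *v y s)$j + (\<Sum>i\<in>{1..N}. (A i *v (gain (hbar i) l *\<^sub>R y s))$j))"
      by (simp add: r_def dd_rhs_def sum_distrib_left distrib_left)
    also have "(A0 *v y s)$j + (\<Sum>i\<in>{1..N}. (A i *v (gain (hbar i) l *\<^sub>R y s))$j) = (exp_mat l *v y s)$j"
      by (simp add: exp_mat_mult_vec matrix_vector_mult_scaleR)
    also have "\<dots> = C * exp (l * s) * (l * w$j - \<eta>)"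
      by (simp add: y_def matrix_vector_mult_scaleR \<eta>_def)
    finally show ?thesis .
  qed
  have "((\<lambda>s. \<bar>A0$j$j\<bar> * \<phi> s - C * exp (l * s) * \<eta>) \<longlongrightarrow> \<bar>A0$j$j\<bar> * \<phi> t1 - C * exp (l * t1) * \<eta>) (at t1 within {0..t1})"
  proof -
    have "continuous_on {0..t1} (\<lambda>s. \<bar>A0$j$j\<bar> * \<phi> s - C * exp (l * s) * \<eta>)"
      unfolding \<phi>_def y_def using H(1) by (auto intro!: continuous_intros xnth)
    then show ?thesis using t1 by (auto simp: continuous_on_def)
  qed
  moreover have "\<bar>A0$j$j\<bar> * \<phi> t1 - C * exp (l * t1) * \<eta> < 0"
  proof -
    have "\<bar>A0$j$j\<bar> * \<phi> t1 \<le> 0" using \<phi>t1 by (simp add: mult_nonneg_nonpos)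
    moreover have "0 < C * exp (l * t1) * \<eta>" using C \<eta> by simp
    ultimately show ?thesis by linarith
  qed
  ultimately have ev: "eventually (\<lambda>s. \<bar>A0$j$j\<bar> * \<phi> s - C * exp (l * s) * \<eta> < 0) (at t1 within {0..t1})"
    by (rule order_tendstoD)
  then obtain d where d: "0 < d" "\<And>s. s \<in> {0..t1} \<Longrightarrow> s \<noteq> t1 \<Longrightarrow> dist s t1 < d \<Longrightarrow> \<bar>A0$j$j\<bar> * \<phi> s - C * exp (l * s) * \<eta> < 0"
    unfolding eventually_at by blast
  \<comment> \<open>Half of \<open>d\<close> keeps the interval strictly inside the neighbourhood;
    the maximum keeps it within nonnegative times.\<close>
  define t0 where "t0 = max 0 (t1 - d / 2)"
  have t0: "0 \<le> t0" "t0 < t1" using t1 d(1) by (auto simp: t0_def)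
  have slope: "\<sigma> * r s $ j \<le> C * w$j * (l * exp (l * s))" if "s \<in> {t0..t1}" for s
  proof -
    have "\<bar>A0$j$j\<bar> * \<phi> s - C * exp (l * s) * \<eta> < 0"
    proof (cases "s = t1")
      case False
      then show ?thesis using that t0 d(1) by (intro d(2)) (auto simp: t0_def dist_real_def)
    qed (use \<open>\<bar>A0$j$j\<bar> * \<phi> t1 - C * exp (l * t1) * \<eta> < 0\<close> in simp)
    with rhs[of s] show ?thesis using that t0 by (simp add: algebra_simps)
  qed
  have rI: "r integrable_on {t0..t1}"
    using integrable_on_subinterval[OF rint[of t1]] t0 t1 by simp
  have "integral {0..t0} r + integral {t0..t1} r = integral {0..t1} r"
    using t0 t1 by (intro Henstock_Kurzweil_Integration.integral_combine rint) auto
  then have "x t1 - x t0 = integral {t0..t1} r"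
    using xeq[of t1] xeq[of t0] t0 t1 by (simp add: algebra_simps)
  then have "(r has_integral x t1 - x t0) {t0..t1}" using rI by (simp add: integrable_integral)
  then have "((\<lambda>s. \<sigma> * r s $ j) has_integral \<sigma> * (x t1 - x t0) $ j) {t0..t1}"
    using has_integral_linear[of r "x t1 - x t0" "{t0..t1}" "\<lambda>z. \<sigma> * z $ j"]
    by (simp add: o_def bounded_linear_mult_const bounded_linear_const_mult bounded_linear_vec_nth)
  moreover have "((\<lambda>s. C * w$j * (l * exp (l * s))) has_integral C * w$j * (exp (l * t1) - exp (l * t0))) {t0..t1}"
  proof (intro has_integral_mult_right fundamental_theorem_of_calculus)
    show "((\<lambda>s. exp (l * s)) has_vector_derivative l * exp (l * s)) (at s within {t0..t1})" for s
      by (auto intro!: derivative_eq_intros simp: has_real_derivative_iff_has_vector_derivative[symmetric])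
  qed (use t0 in simp)
  ultimately have "\<sigma> * (x t1 - x t0) $ j \<le> C * w$j * (exp (l * t1) - exp (l * t0))"
    using slope by (rule has_integral_le)
  \<comment> \<open>The bound grows at least as much as \<open>\<sigma> * x s $ j\<close> on the
    interval, so a gap that is positive at \<open>t0\<close> cannot close at
    \<open>t1\<close>.\<close>
  then have "\<phi> t0 \<le> \<phi> t1" by (simp add: \<phi>_def y_def algebra_simps)
  moreover have "0 < \<phi> t0"
    using lt[of t0 j] \<sigma>le[of "x t0 $ j"] t0 H(1) by (simp add: \<phi>_def)
  ultimately show False using \<phi>t1 by simp
qed

text \<open>One exponential estimate gives both stability and attraction. Its rate \<open>l\<close>
  and constants \<open>m\<close> and the sum of \<open>w\<close> are chosen independently of the
  delay functions.\<close>

lemma asymp_stable_if_stab: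
  assumes stab: "stab (exp_mat 0)"
    and h: "\<And>i t. i \<in> {1..N} \<Longrightarrow> 0 \<le> t \<Longrightarrow> 0 \<le> h i t \<and> h i t \<le> hbar i"
    and H: "0 \<le> H" "\<And>i. i \<in> {1..N} \<Longrightarrow> hbar i \<le> H"
  shows "dd_asymp_stable A0 A N H h"
proof -
  obtain w where w: "\<And>j. 0 < w$j" "exp_mat 0 *v w = - 1"
    using stab_imp_right_one[OF metzler_exp_mat stab] by blast
  have "((\<lambda>l. exp_mat l *v w - l *\<^sub>R w) \<longlongrightarrow> exp_mat 0 *v w - 0 *\<^sub>R w) (at_left 0)"
  proof -
    have "continuous_on UNIV (\<lambda>l. exp_mat l *v w - l *\<^sub>R w)"
      unfolding matrix_vector_mult_def by (intro continuous_intros continuous_on_exp_mat)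
    then have "((\<lambda>l. exp_mat l *v w - l *\<^sub>R w) \<longlongrightarrow> exp_mat 0 *v w - 0 *\<^sub>R w) (at 0 within UNIV)"
      unfolding continuous_on_def by blast
    then show ?thesis by (rule tendsto_within_subset) simp
  qed
  then have "eventually (\<lambda>l. \<forall>j. (exp_mat l *v w - l *\<^sub>R w) $ j < 0) (at_left 0)"
    by (rule eventually_vec_neg) (simp add: w(2))
  moreover have "eventually (\<lambda>l. l < 0) (at_left (0::real))"
    by (simp add: eventually_at_filter)
  ultimately have "eventually (\<lambda>l. l < 0 \<and> (\<forall>j. (exp_mat l *v w - l *\<^sub>R w) $ j < 0)) (at_left 0)"
    by eventually_elim auto
  then obtain l where l: "l < 0" "\<And>j. (exp_mat l *v w) $ j < l * w$j"
    using eventually_happens'[OF trivial_limit_at_left_real] by force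
  \<comment> \<open>Dividing by the least coordinate makes \<open>(b / m) *\<^sub>R w\<close> at
    least \<open>b\<close> in every coordinate.\<close>
  define m where "m = Min (range (\<lambda>j. w$j))"
  have m: "0 < m" "m \<le> w$j" for j
    using w(1) by (auto simp: m_def)
  have bound: "norm (x t) \<le> b / m * exp (l * t) * (\<Sum>j\<in>UNIV. w$j)"
    if x: "dd_solution A0 A N H h x" "\<And>s. -H \<le> s \<Longrightarrow> s \<le> 0 \<Longrightarrow> norm (x s) < b" and t: "0 \<le> t" for x b t
  proof -
    have b: "0 < b" using x(2)[of 0] H(1) norm_ge_zero[of "x 0"] by linarith
    have "\<bar>x s $ j\<bar> < b / m * exp (l * s) * w$j" if "-H \<le> s" "s \<le> 0" for s j
    proof -
      have "\<bar>x s $ j\<bar> < b" using component_le_norm_cart[of "x s" j] x(2)[OF that] by linarith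
      also have "b \<le> (b / m) * w$j" using b m(1) m(2)[of j] by (simp add: field_simps)
      \<comment> \<open>On the history both \<open>l\<close> and \<open>s\<close> are nonpositive,
        so the exponential is at least 1.\<close>
      also have "\<dots> \<le> exp (l * s) * ((b / m) * w$j)"
        using mult_right_mono[of 1 "exp (l * s)" "(b / m) * w$j"] l(1) that b m(1) w(1)[of j]
        by (simp add: mult_nonpos_nonpos)
      finally show ?thesis by (simp add: ac_simps)
    qed
    moreover have "0 < b / m" using b m(1) by simp
    ultimately have "\<bar>x t $ j\<bar> < b / m * exp (l * t) * w$j" for j
      by (intro comparison[OF x(1) h H w(1) l(2) _ _ t])
    then have "(\<Sum>j\<in>UNIV. \<bar>x t $ j\<bar>) \<le> (\<Sum>j\<in>UNIV. b / m * exp (l * t) * w$j)"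
      by (intro sum_mono less_imp_le)
    then show ?thesis
      using norm_le_l1_cart[of "x t"] by (simp add: sum_distrib_left)
  qed
  define W where "W = (\<Sum>j\<in>UNIV. w$j)"
  have W: "0 < W" unfolding W_def using w(1) by (intro sum_pos) auto
  show ?thesis
    unfolding dd_asymp_stable_def
  proof (intro conjI allI impI)
    fix \<epsilon> :: real assume "0 < \<epsilon>"
    \<comment> \<open>Chosen so that the estimate becomes
      \<open>exp (l * t) * (\<epsilon> / 2)\<close>; the 2 restores strictness.\<close>
    define \<delta> where "\<delta> = \<epsilon> * m / (2 * W)"
    have "0 < \<delta>" using \<open>0 < \<epsilon>\<close> m W by (simp add: \<delta>_def)
    moreover have "norm (x t) < \<epsilon>"
      if x: "dd_solution A0 A N H h x" "\<forall>s\<in>{-H..0}. norm (x s) < \<delta>" and t: "0 \<le> t" for x t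
    proof -
      have "norm (x t) \<le> (\<delta> / m) * exp (l * t) * W"
        unfolding W_def using x t by (intro bound) auto
      also have "\<dots> = exp (l * t) * (\<epsilon> / 2)"
        using m(1) W by (simp add: \<delta>_def)
      also have "\<dots> \<le> 1 * (\<epsilon> / 2)"
        using l(1) t \<open>0 < \<epsilon>\<close> by (intro mult_right_mono) (auto simp: mult_nonpos_nonneg)
      also have "\<dots> < \<epsilon>" using \<open>0 < \<epsilon>\<close> by simp
      finally show ?thesis .
    qed
    ultimately show "\<exists>\<delta>>0. \<forall>x. dd_solution A0 A N H h x \<and> (\<forall>s\<in>{-H..0}. norm (x s) < \<delta>)
        \<longrightarrow> (\<forall>t\<ge>0. norm (x t) < \<epsilon>)"
      by blast
  next
    fix x assume x: "dd_solution A0 A N H h x"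
    then have "continuous_on {-H..0} x"
      unfolding dd_solution_def by (auto intro: continuous_on_subset)
    then have "bounded (x ` {-H..0})"
      by (intro compact_imp_bounded compact_continuous_image) auto
    then obtain b where b: "\<And>s. s \<in> {-H..0} \<Longrightarrow> norm (x s) \<le> b"
      unfolding bounded_iff by blast
    have "norm (x t) \<le> (b + 1) / m * exp (l * t) * W" if "0 \<le> t" for t
      unfolding W_def
    proof (rule bound[OF x _ that])
      show "norm (x s) < b + 1" if "- H \<le> s" "s \<le> 0" for s using b[of s] that by simp
    qed
    then have "eventually (\<lambda>t. norm (x t) \<le> (b + 1) / m * exp (l * t) * W) at_top"
      by (intro eventually_mono[OF eventually_ge_at_top[of 0]])
    moreover have "((\<lambda>t. (b + 1) / m * exp (l * t) * W) \<longlongrightarrow> 0) at_top"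
    proof -
      have "filterlim (\<lambda>t. l * t) at_bot at_top"
        by (rule filterlim_tendsto_neg_mult_at_bot[OF tendsto_const l(1) filterlim_ident])
      then have "((\<lambda>t. exp (l * t)) \<longlongrightarrow> 0) at_top"
        by (rule filterlim_compose[OF exp_at_bot])
      then show ?thesis
        by (intro tendsto_mult_left_zero tendsto_mult_right_zero)
    qed
    ultimately show "(x \<longlongrightarrow> 0) at_top"
      by (rule Lim_null_comparison)
  qed
qed

end

section \<open>Spectral radius conditions as stability of shifted matrices\<close>

lemma schur_stable_iff_stab:
  fixes K :: "real^'n^'n"
  assumes "nonneg_mat K"
  shows "schur_stable K \<longleftrightarrow> stab (K - 1 *\<^sub>R mat 1)"
  unfolding schur_stable_def
  using spectral_radius_nonneg_mat(2,3)[OF assms, of 1] by (metis zero_le_one)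

text \<open>In HOL \<open>1 / 0 = 0\<close>, so the disjunct for spectral radius 0 expresses the
  convention that 1/0 is infinite. Positive \<open>c\<close> rescales the shift to
  \<open>1 / c\<close>; for \<open>c = 0\<close> the shifted matrix is minus the identity.\<close>

lemma mult_spectral_radius_less_one_iff:
  fixes K :: "real^'n^'n"
  assumes K: "nonneg_mat K" and c: "0 \<le> c"
  shows "spectral_radius K = 0 \<or> c < 1 / spectral_radius K \<longleftrightarrow> stab (c *\<^sub>R K - 1 *\<^sub>R mat 1)"
proof -
  have cK: "nonneg_mat (c *\<^sub>R K)" using K c by (simp add: nonneg_mat_def)
  have "spectral_radius K = 0 \<or> c < 1 / spectral_radius K \<longleftrightarrow> c * spectral_radius K < 1"
    using spectral_radius_nonneg_mat(1)[OF K] by (cases "spectral_radius K = 0") (simp_all add: pos_less_divide_eq)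
  also have "\<dots> \<longleftrightarrow> stab (c *\<^sub>R K - 1 *\<^sub>R mat 1)"
  proof (cases "c = 0")
    case True
    have "stab ((0 :: real^'n^'n) - 1 *\<^sub>R mat 1)"
      by (intro stab_shift_large) (auto simp: metzler_def)
    then show ?thesis using True by simp
  next
    case False
    then have c0: "0 < c" using c by simp
    have "c * spectral_radius K < 1 \<longleftrightarrow> spectral_radius K < 1 / c"
      using c0 by (simp add: field_simps)
    also have "\<dots> \<longleftrightarrow> stab (K - (1 / c) *\<^sub>R mat 1)"
      using spectral_radius_nonneg_mat(2,3)[OF K, of "1 / c"] c by auto
    also have "\<dots> \<longleftrightarrow> stab (c *\<^sub>R (K - (1 / c) *\<^sub>R mat 1))"
      by (simp only: stab_scaleR[OF c0])
    also have "c *\<^sub>R (K - (1 / c) *\<^sub>R mat 1) = c *\<^sub>R K - 1 *\<^sub>R mat 1"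
      using c0 by (simp add: scaleR_diff_right)
    finally show ?thesis .
  qed
  finally show ?thesis .
qed

subsection \<open>The equivalences\<close>

theorem theorem15:
  fixes A0 :: "real^'n^'n" and A :: "nat \<Rightarrow> real^'n^'n"
    and hbar :: "nat \<Rightarrow> real" and N :: nat
  assumes "metzler A0"
    and "\<forall>i\<in>{1..N}. nonneg_mat (A i)"
    and "\<forall>i\<in>{1..N}. 0 \<le> hbar i"
  defines "M \<equiv> A0 + (\<Sum>i\<in>{1..N}. hbar i *\<^sub>R A i)"
  shows "((\<forall>h. (\<forall>i\<in>{1..N}. \<forall>t\<ge>0. 0 \<le> h i t \<and> h i t \<le> hbar i)
               \<longrightarrow> dd_asymp_stable A0 A N (max_delay N hbar) h)
          \<longleftrightarrow> hurwitz M)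
       \<and> (hurwitz M \<longleftrightarrow> (\<exists>v. (\<forall>j. 0 < v$j) \<and> (\<forall>j. (v v* M)$j < 0)))
       \<and> (hurwitz M \<longleftrightarrow>
            hurwitz A0 \<and> schur_stable (- (\<Sum>i\<in>{1..N}. hbar i *\<^sub>R A i) ** matrix_inv A0))
       \<and> (hurwitz M \<longleftrightarrow>
            (\<exists>P Q. pos_diag P \<and> (\<forall>i\<in>{1..N}. pos_diag (Q i)) \<and>
               neg_definite (transpose A0 ** P + P ** A0 +
                 (\<Sum>i\<in>{1..N}. Q i + (hbar i)\<^sup>2 *\<^sub>R
                     (P ** A i ** matrix_inv (Q i) ** transpose (A i) ** P)))))
       \<and> (N = 1 \<longrightarrow> (hurwitz M \<longleftrightarrow>
            hurwitz A0 \<and> (let r = spectral_radius (matrix_inv A0 ** A 1)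
                           in r = 0 \<or> hbar 1 < 1 / r)))"
proof -
  interpret delay_system A0 A N hbar
    using assms(1-3) by unfold_locales auto
  define B where "B = (\<Sum>i\<in>{1..N}. hbar i *\<^sub>R A i)"
  have B: "nonneg_mat B"
    unfolding B_def by (rule nonneg_mat_weighted_sum[OF A hbar])
  have M: "M = exp_mat 0" "M = A0 + B" by (simp_all add: M_def B_def exp_mat_zero)
  have hM: "hurwitz M \<longleftrightarrow> stab M"
    unfolding M(1) by (rule hurwitz_iff_stab[OF metzler_exp_mat])
  have hA0: "hurwitz A0 \<longleftrightarrow> stab A0"
    by (rule hurwitz_iff_stab[OF A0])
  have H: "0 \<le> max_delay N hbar" "\<And>i. i \<in> {1..N} \<Longrightarrow> hbar i \<le> max_delay N hbar"
    unfolding max_delay_def by (auto intro!: Max_ge simp del: Max_insert)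
  have "(\<forall>h. (\<forall>i\<in>{1..N}. \<forall>t\<ge>0. 0 \<le> h i t \<and> h i t \<le> hbar i)
      \<longrightarrow> dd_asymp_stable A0 A N (max_delay N hbar) h) \<longleftrightarrow> hurwitz M" (is "?stable \<longleftrightarrow> _")
  proof
    assume ?stable
    then have "dd_asymp_stable A0 A N (max_delay N hbar) (\<lambda>i t. hbar i)"
      using hbar by simp
    then have "stab M" unfolding M(1) by (rule stab_if_asymp_stable)
    then show "hurwitz M" unfolding hM .
  next
    assume "hurwitz M"
    then have "stab (exp_mat 0)" unfolding hM unfolding M(1) .
    then show ?stable using H by (auto intro: asymp_stable_if_stab)
  qed
  moreover have "hurwitz M \<longleftrightarrow> (\<exists>v. (\<forall>j. 0 < v$j) \<and> (\<forall>j. (v v* M)$j < 0))"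
    unfolding hM by (meson stab_if_left stab_imp_left)
  moreover have "hurwitz M \<longleftrightarrow> hurwitz A0 \<and> schur_stable (- B ** matrix_inv A0)"
  proof -
    \<comment> \<open>Nonnegativity is available only for stable \<open>A0\<close>, which both sides
      of the equivalence contain.\<close>
    have "nonneg_mat (B ** - matrix_inv A0)" if "stab A0"
      using nonneg_mat_mult[OF B nonneg_mat_neg_inverse[OF A0 that]] .
    then show ?thesis
      unfolding hM hA0 unfolding M(2) stab_add_iff_left[OF A0 B]
      using schur_stable_iff_stab[of "B ** - matrix_inv A0"] by (auto simp: matrix_minus_mult)
  qed
  moreover have "hurwitz M \<longleftrightarrow>
      (\<exists>P Q. pos_diag P \<and> (\<forall>i\<in>{1..N}. pos_diag (Q i)) \<and>
         neg_definite (transpose A0 ** P + P ** A0 +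
           (\<Sum>i\<in>{1..N}. Q i + (hbar i)\<^sup>2 *\<^sub>R
               (P ** A i ** matrix_inv (Q i) ** transpose (A i) ** P))))" (is "_ \<longleftrightarrow> ?lmi")
  proof
    assume "hurwitz M"
    then have st: "stab (A0 + (\<Sum>i\<in>{1..N}. hbar i *\<^sub>R A i))" unfolding hM unfolding M_def .
    show ?lmi by (rule lmi_if_stab[OF A0 A hbar st]) blast+
  next
    assume ?lmi
    then obtain P Q where PQ: "pos_diag P" "\<And>i. i \<in> {1..N} \<Longrightarrow> pos_diag (Q i)"
      "neg_definite (transpose A0 ** P + P ** A0 +
         (\<Sum>i\<in>{1..N}. Q i + (hbar i)\<^sup>2 *\<^sub>R
             (P ** A i ** matrix_inv (Q i) ** transpose (A i) ** P)))"
      by blast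
    show "hurwitz M"
      unfolding hM unfolding M_def by (rule stab_if_lmi[OF A0 A hbar PQ])
  qed
  moreover have "hurwitz M \<longleftrightarrow> hurwitz A0 \<and> (let r = spectral_radius (matrix_inv A0 ** A 1)
      in r = 0 \<or> hbar 1 < 1 / r)" if N: "N = 1"
  proof -
    have A1: "nonneg_mat (A 1)" "0 \<le> hbar 1" using A[of 1] hbar[of 1] N by auto
    \<comment> \<open>The sign makes \<open>K\<close> nonnegative for stable \<open>A0\<close> and
      leaves the spectral radius unchanged.\<close>
    define K where "K = - matrix_inv A0 ** A 1"
    have "nonneg_mat K" if "stab A0"
      unfolding K_def using nonneg_mat_mult[OF nonneg_mat_neg_inverse[OF A0 that] A1(1)] .
    moreover have "- matrix_inv A0 ** B = hbar 1 *\<^sub>R K"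
      by (simp add: B_def N K_def matrix_scalar_ac scalar_matrix_assoc)
    moreover have "spectral_radius (matrix_inv A0 ** A 1) = spectral_radius K"
      by (simp add: K_def matrix_minus_mult spectral_radius_uminus)
    ultimately show ?thesis
      unfolding hM hA0 unfolding M(2) stab_add_iff_right[OF A0 B]
      using mult_spectral_radius_less_one_iff[OF _ A1(2), of K] by (auto simp: Let_def)
  qed
  ultimately show ?thesis unfolding B_def by blast
qed

end
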